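(* Let $\Delta$ be a smooth fan in $N_{\mathbb R}$, $N\cong\mathbb Z^n$, with primitive edge vectors $v_1,\dots,v_d$, such that $X=X(\Delta)$ is connected, $v_1,\dots,v_n$ form a basis of $N\otimes_{\mathbb Z}\mathbb Z_2$, and $\langle v_p,v_q\rangle\in\Delta$ for all $1\le p,q\le n$. Then every nontrivial torsion element of $\pi_1(X)$ has order $2$. In particular, when $\pi_1(X)$ is abelian, for each $n+1\le j\le d$ the element $S_j=s_j\cdot s_1^{a_{j,1}}\cdots s_n^{a_{j,n}}\in\pi_1(X)$ is of order $2$ if and only if $\langle v_j,v_i\rangle\in\Delta$ for all $1\le i\le n$, and it is of infinite order if and only if there exists a unique $1\le i_j\le n$ such that $\langle v_j,v_{i_j}\rangle\notin\Delta$.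
   Context: $N\cong\mathbb Z^n$, $M=\mathrm{Hom}(N,\mathbb Z)$, $N_{\mathbb R}=N\otimes\mathbb R$, $\mathbb Z_2=\mathbb Z/2$. A smooth fan is a finite fan of strongly convex rational polyhedral cones, each generated by part of a $\mathbb Z$-basis of $N$ (not necessarily complete); $v_1,\dots,v_d$ are the primitive lattice vectors along its one-dimensional cones; $\langle v_p,v_q\rangle$ denotes the cone generated by $v_p,v_q$. The real toric variety $X(\Delta)$ is the set of real points of the complex toric variety of $\Delta$ with its classical topology: it is obtained by gluing $U_\sigma=\mathrm{Hom}_{sg}(\sigma^\vee\cap M,\mathbb R)$, $\sigma\in\Delta$ (homomorphisms from the additive semigroup to the multiplicative semigroup $\mathbb R$ sending $0$ to $1$). Let $u_1,\dots,u_n$ be the basis of $M\otimes\mathbb Z_2$ dual to $v_1,\dots,v_n$ and $a_{j,i}=\langle u_i,v_j\rangle\in\mathbb Z_2$ (dual pairing). Let $W(\Delta)=\langle s_1,\dots,s_d\mid s_j^2,\ (s_is_j)^2\text{ whenever }\langle v_i,v_j\rangle\in\Delta\rangle$. The group $\pi_1(X)$ is identified with the kernel of the surjection $\widehat\varphi:W(\Delta)\to N\otimes\mathbb Z_2$, $s_j\mapsto v_j\bmod 2$; the $S_j$ lie in this kernel. *)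

theory Defs
  imports
    "HOL-Analysis.Analysis"
    "HOL-Algebra.Coset"
    "HOL-Algebra.Multiplicative_Group"
    "HOL-Library.Z2"
begin

section \<open>Smooth fans\<close>

text \<open>
  The lattice is \<open>N = int ^ 'n\<close> with \<open>n = CARD('n)\<close>, sitting in \<open>real ^ 'n\<close> by \<open>latt\<close>.
  The dual lattice \<open>M = Hom(N, Z)\<close> is also written as \<open>int ^ 'n\<close>, a vector \<open>m\<close> standing for the
  functional \<open>x \<mapsto> latt m \<bullet> x\<close>.
\<close>

definition latt :: "int ^ 'n \<Rightarrow> real ^ 'n" where
  "latt z = (\<chi> i. real_of_int (z $ i))"

definition lattice_basis :: "(int ^ 'n) set \<Rightarrow> bool" where
  "lattice_basis B \<longleftrightarrow> finite B \<and>
     (\<forall>z. \<exists>!c :: int ^ 'n \<Rightarrow> int. (\<forall>b. b \<notin> B \<longrightarrow> c b = 0) \<and> z = (\<Sum>b\<in>B. c b *s b))"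

definition rational_polyhedral_cone :: "(real ^ 'n) set \<Rightarrow> bool" where
  "rational_polyhedral_cone \<sigma> \<longleftrightarrow>
     (\<exists>F :: (int ^ 'n) set. finite F \<and> \<sigma> = convex_cone hull (latt ` F))"

definition strongly_convex :: "(real ^ 'n) set \<Rightarrow> bool" where
  "strongly_convex \<sigma> \<longleftrightarrow> \<sigma> \<inter> uminus ` \<sigma> = {0}"

text \<open>
  The library counts the empty set as a face of every convex set; faces of cones are nonempty.
\<close>

definition cone_face :: "(real ^ 'n) set \<Rightarrow> (real ^ 'n) set \<Rightarrow> bool" where
  "cone_face \<tau> \<sigma> \<longleftrightarrow> \<tau> face_of \<sigma> \<and> \<tau> \<noteq> {}"

definition is_fan :: "(real ^ 'n) set set \<Rightarrow> bool" where
  "is_fan \<Delta> \<longleftrightarrow> finite \<Delta> \<and>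
     (\<forall>\<sigma>\<in>\<Delta>. rational_polyhedral_cone \<sigma> \<and> strongly_convex \<sigma>) \<and>
     (\<forall>\<sigma>\<in>\<Delta>. \<forall>\<tau>. cone_face \<tau> \<sigma> \<longrightarrow> \<tau> \<in> \<Delta>) \<and>
     (\<forall>\<sigma>\<in>\<Delta>. \<forall>\<tau>\<in>\<Delta>. cone_face (\<sigma> \<inter> \<tau>) \<sigma> \<and> cone_face (\<sigma> \<inter> \<tau>) \<tau>)"

definition smooth_fan :: "(real ^ 'n) set set \<Rightarrow> bool" where
  "smooth_fan \<Delta> \<longleftrightarrow> is_fan \<Delta> \<and>
     (\<forall>\<sigma>\<in>\<Delta>. \<exists>B F. lattice_basis B \<and> F \<subseteq> B \<and> \<sigma> = convex_cone hull (latt ` F))"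

definition primitive_vector :: "int ^ 'n \<Rightarrow> bool" where
  "primitive_vector z \<longleftrightarrow> (\<forall>k w. z = k *s w \<longrightarrow> \<bar>k\<bar> = 1)"

definition primitive_edge_vectors :: "(real ^ 'n) set set \<Rightarrow> (int ^ 'n) set" where
  "primitive_edge_vectors \<Delta> =
     {z. primitive_vector z \<and> (\<exists>\<rho>\<in>\<Delta>. dim \<rho> = 1 \<and> latt z \<in> \<rho>)}"

definition cone2 :: "int ^ 'n \<Rightarrow> int ^ 'n \<Rightarrow> (real ^ 'n) set" where
  "cone2 x y = convex_cone hull {latt x, latt y}"


section \<open>The real toric variety of a fan\<close>

definition quotient_topology :: "'a topology \<Rightarrow> ('a \<Rightarrow> 'b) \<Rightarrow> 'b topology" where
  "quotient_topology X q =
     topology (\<lambda>U. U \<subseteq> q ` topspace X \<and> openin X {x \<in> topspace X. q x \<in> U})"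

lemma openin_quotient_topology:
  "openin (quotient_topology X q) U \<longleftrightarrow>
     U \<subseteq> q ` topspace X \<and> openin X {x \<in> topspace X. q x \<in> U}"
proof -
  have "istopology (\<lambda>U. U \<subseteq> q ` topspace X \<and> openin X {x \<in> topspace X. q x \<in> U})"
    unfolding istopology_def
  proof (intro conjI allI impI)
    fix S T
    assume S: "S \<subseteq> q ` topspace X \<and> openin X {x \<in> topspace X. q x \<in> S}"
      and T: "T \<subseteq> q ` topspace X \<and> openin X {x \<in> topspace X. q x \<in> T}"
    show "S \<inter> T \<subseteq> q ` topspace X" using S by blast
    have "{x \<in> topspace X. q x \<in> S \<inter> T} =
        {x \<in> topspace X. q x \<in> S} \<inter> {x \<in> topspace X. q x \<in> T}" by blast
    then show "openin X {x \<in> topspace X. q x \<in> S \<inter> T}" using S T by auto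
  next
    fix \<K>
    assume K: "\<forall>K\<in>\<K>. K \<subseteq> q ` topspace X \<and> openin X {x \<in> topspace X. q x \<in> K}"
    show "\<Union>\<K> \<subseteq> q ` topspace X" using K by blast
    have "{x \<in> topspace X. q x \<in> \<Union>\<K>} = (\<Union>K\<in>\<K>. {x \<in> topspace X. q x \<in> K})" by blast
    then show "openin X {x \<in> topspace X. q x \<in> \<Union>\<K>}" using K by auto
  qed
  then show ?thesis
    by (simp add: quotient_topology_def topology_inverse')
qed

lemma topspace_quotient_topology: "topspace (quotient_topology X q) = q ` topspace X"
proof
  show "topspace (quotient_topology X q) \<subseteq> q ` topspace X"
    by (metis openin_quotient_topology openin_topspace)
  have "{x \<in> topspace X. q x \<in> q ` topspace X} = topspace X" by blast
  then have "openin (quotient_topology X q) (q ` topspace X)"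
    by (simp add: openin_quotient_topology)
  then show "q ` topspace X \<subseteq> topspace (quotient_topology X q)"
    by (rule openin_subset)
qed

definition dual_monoid :: "(real ^ 'n) set \<Rightarrow> (int ^ 'n) set" where
  "dual_monoid \<sigma> = {m. \<forall>x\<in>\<sigma>. 0 \<le> latt m \<bullet> x}"

definition chart_points :: "(real ^ 'n) set \<Rightarrow> (int ^ 'n \<Rightarrow> real) set" where
  "chart_points \<sigma> = {f \<in> extensional (dual_monoid \<sigma>). f 0 = 1 \<and>
     (\<forall>m\<in>dual_monoid \<sigma>. \<forall>m'\<in>dual_monoid \<sigma>. f (m + m') = f m * f m')}"

text \<open>
  The classical topology on \<open>Hom\<^sub>s\<^sub>g(\<sigma>\<^sup>\<or> \<inter> M, \<real>)\<close> is that of pointwise convergence: for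
  generators \<open>m\<^sub>1, \<dots>, m\<^sub>k\<close> of the semigroup, \<open>f \<mapsto> (f m\<^sub>1, \<dots>, f m\<^sub>k)\<close> is a homeomorphism onto the
  corresponding real affine variety in \<open>\<real>\<^sup>k\<close>.
\<close>

definition chart :: "(real ^ 'n) set \<Rightarrow> (int ^ 'n \<Rightarrow> real) topology" where
  "chart \<sigma> = subtopology (product_topology (\<lambda>_. euclideanreal) (dual_monoid \<sigma>)) (chart_points \<sigma>)"

text \<open>
  For a face \<open>\<tau>\<close> of \<open>\<sigma>\<close>, restriction of homomorphisms embeds the chart of \<open>\<tau>\<close> in the chart of
  \<open>\<sigma>\<close>. The variety is the disjoint union of the charts modulo the equivalence relation
  generated by identifying each \<open>f\<close> with its restrictions.
\<close>

definition gluing ::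
  "(real ^ 'n) set set \<Rightarrow> (((real ^ 'n) set \<times> (int ^ 'n \<Rightarrow> real)) \<times> ((real ^ 'n) set \<times> (int ^ 'n \<Rightarrow> real))) set"
  where
  "gluing \<Delta> = {((\<tau>, f), (\<sigma>, restrict f (dual_monoid \<sigma>))) | \<tau> \<sigma> f.
     \<tau> \<in> \<Delta> \<and> \<sigma> \<in> \<Delta> \<and> cone_face \<tau> \<sigma> \<and> f \<in> chart_points \<tau>}"

definition real_toric_variety ::
  "(real ^ 'n) set set \<Rightarrow> ((real ^ 'n) set \<times> (int ^ 'n \<Rightarrow> real)) set topology" where
  "real_toric_variety \<Delta> =
     quotient_topology (sum_topology chart \<Delta>) (\<lambda>p. (gluing \<Delta> \<union> (gluing \<Delta>)\<inverse>)\<^sup>* `` {p})"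


section \<open>The fundamental group of a topological space\<close>

definition loops_at :: "'a topology \<Rightarrow> 'a \<Rightarrow> (real \<Rightarrow> 'a) set" where
  "loops_at X x0 = {p. pathin X p \<and> p 0 = x0 \<and> p 1 = x0}"

definition loop_homotopic :: "'a topology \<Rightarrow> 'a \<Rightarrow> (real \<Rightarrow> 'a) \<Rightarrow> (real \<Rightarrow> 'a) \<Rightarrow> bool" where
  "loop_homotopic X x0 = homotopic_with (\<lambda>r. r 0 = x0 \<and> r 1 = x0) (top_of_set {0..1}) X"

definition loop_class :: "'a topology \<Rightarrow> 'a \<Rightarrow> (real \<Rightarrow> 'a) \<Rightarrow> (real \<Rightarrow> 'a) set" where
  "loop_class X x0 p = {q \<in> loops_at X x0. loop_homotopic X x0 p q}"

text \<open>The library's \<open>p +++ q\<close>, without its restriction to topological type classes.\<close>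

definition loop_join :: "(real \<Rightarrow> 'a) \<Rightarrow> (real \<Rightarrow> 'a) \<Rightarrow> real \<Rightarrow> 'a" where
  "loop_join p q = (\<lambda>t. if t \<le> 1/2 then p (2 * t) else q (2 * t - 1))"

definition fundamental_group :: "'a topology \<Rightarrow> 'a \<Rightarrow> (real \<Rightarrow> 'a) set monoid" where
  "fundamental_group X x0 =
     \<lparr>carrier = loop_class X x0 ` loops_at X x0,
      mult = (\<lambda>A B. \<Union>p\<in>A. \<Union>q\<in>B. loop_class X x0 (loop_join p q)),
      one = loop_class X x0 (\<lambda>_. x0)\<rparr>"


section \<open>Groups given by generators and relations\<close>

text \<open>
  A letter \<open>(x, True)\<close> stands for the generator \<open>x\<close> and \<open>(x, False)\<close> for its inverse.
\<close>

definition words_over :: "'a set \<Rightarrow> ('a \<times> bool) list set" where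
  "words_over S = lists (S \<times> UNIV)"

definition pres_step ::
  "'a set \<Rightarrow> ('a \<times> bool) list set \<Rightarrow> (('a \<times> bool) list \<times> ('a \<times> bool) list) set" where
  "pres_step S R =
     {(u @ [(x, b), (x, \<not> b)] @ w, u @ w) | u x b w. u \<in> words_over S \<and> w \<in> words_over S \<and> x \<in> S} \<union>
     {(u @ r @ w, u @ w) | u r w. u \<in> words_over S \<and> w \<in> words_over S \<and> r \<in> R}"

definition pres_class ::
  "'a set \<Rightarrow> ('a \<times> bool) list set \<Rightarrow> ('a \<times> bool) list \<Rightarrow> ('a \<times> bool) list set" where
  "pres_class S R w = (pres_step S R \<union> (pres_step S R)\<inverse>)\<^sup>* `` {w}"

definition presented_group ::
  "'a set \<Rightarrow> ('a \<times> bool) list set \<Rightarrow> ('a \<times> bool) list set monoid" where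
  "presented_group S R =
     \<lparr>carrier = pres_class S R ` words_over S,
      mult = (\<lambda>A B. \<Union>u\<in>A. \<Union>w\<in>B. pres_class S R (u @ w)),
      one = pres_class S R []\<rparr>"

definition word_eval :: "('g, 'm) monoid_scheme \<Rightarrow> ('a \<Rightarrow> 'g) \<Rightarrow> ('a \<times> bool) list \<Rightarrow> 'g" where
  "word_eval H f w =
     foldr (\<lambda>(x, b) g. (if b then f x else inv\<^bsub>H\<^esub> (f x)) \<otimes>\<^bsub>H\<^esub> g) w \<one>\<^bsub>H\<^esub>"

text \<open>
  The homomorphism out of a presented group that sends each generator \<open>x\<close> to \<open>f x\<close>. The set of
  values on a class is a singleton whenever \<open>f\<close> respects the relators.
\<close>

definition pres_lift ::
  "('g, 'm) monoid_scheme \<Rightarrow> ('a \<Rightarrow> 'g) \<Rightarrow> ('a \<times> bool) list set \<Rightarrow> 'g" where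
  "pres_lift H f C = the_elem (word_eval H f ` C)"


section \<open>Reduction modulo 2 and the group of the fan\<close>

definition mod2 :: "int ^ 'n \<Rightarrow> bit ^ 'n" where
  "mod2 z = (\<chi> i. of_int (z $ i))"

definition pairing2 :: "bit ^ 'n \<Rightarrow> bit ^ 'n \<Rightarrow> bit" where
  "pairing2 u x = (\<Sum>i\<in>UNIV. u $ i * x $ i)"

definition family_basis :: "'i set \<Rightarrow> ('i \<Rightarrow> 'a::field ^ 'n) \<Rightarrow> bool" where
  "family_basis I b \<longleftrightarrow>
     inj_on b I \<and> vec.independent (b ` I) \<and> vec.span (b ` I) = UNIV"

definition N2_group :: "(bit ^ 'n) monoid" where
  "N2_group = \<lparr>carrier = UNIV, mult = (+), one = 0\<rparr>"

definition W_relators :: "(real ^ 'n) set set \<Rightarrow> nat \<Rightarrow> (nat \<Rightarrow> int ^ 'n) \<Rightarrow> (nat \<times> bool) list set" where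
  "W_relators \<Delta> d v =
     {[(j, True), (j, True)] | j. j \<in> {1..d}} \<union>
     {[(i, True), (j, True), (i, True), (j, True)] | i j.
        i \<in> {1..d} \<and> j \<in> {1..d} \<and> cone2 (v i) (v j) \<in> \<Delta>}"

definition W_group ::
  "(real ^ 'n) set set \<Rightarrow> nat \<Rightarrow> (nat \<Rightarrow> int ^ 'n) \<Rightarrow> (nat \<times> bool) list set monoid" where
  "W_group \<Delta> d v = presented_group {1..d} (W_relators \<Delta> d v)"

definition W_gen ::
  "(real ^ 'n) set set \<Rightarrow> nat \<Rightarrow> (nat \<Rightarrow> int ^ 'n) \<Rightarrow> nat \<Rightarrow> (nat \<times> bool) list set" where
  "W_gen \<Delta> d v j = pres_class {1..d} (W_relators \<Delta> d v) [(j, True)]"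

definition phi_hat :: "(nat \<Rightarrow> int ^ 'n) \<Rightarrow> (nat \<times> bool) list set \<Rightarrow> bit ^ 'n" where
  "phi_hat v = pres_lift N2_group (\<lambda>j. mod2 (v j))"

definition W_kernel ::
  "(real ^ 'n) set set \<Rightarrow> nat \<Rightarrow> (nat \<Rightarrow> int ^ 'n) \<Rightarrow> (nat \<times> bool) list set monoid" where
  "W_kernel \<Delta> d v =
     (W_group \<Delta> d v)\<lparr>carrier := kernel (W_group \<Delta> d v) N2_group (phi_hat v)\<rparr>"

definition S_elem ::
  "(real ^ 'n) set set \<Rightarrow> nat \<Rightarrow> (nat \<Rightarrow> int ^ 'n) \<Rightarrow> (nat \<Rightarrow> bit ^ 'n) \<Rightarrow> nat \<Rightarrow> (nat \<times> bool) list set" where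
  "S_elem \<Delta> d v u j =
     W_gen \<Delta> d v j \<otimes>\<^bsub>W_group \<Delta> d v\<^esub>
     foldr (\<lambda>i g. (W_gen \<Delta> d v i [^]\<^bsub>W_group \<Delta> d v\<^esub> (of_bool (pairing2 (u i) (mod2 (v j)) = 1) :: nat))
                   \<otimes>\<^bsub>W_group \<Delta> d v\<^esub> g)
       [1..<Suc (CARD('n))] \<one>\<^bsub>W_group \<Delta> d v\<^esub>"

end

(*
  W is a right-angled Coxeter group. For a set A of generators and a further generator v, the
  kernel of the retraction of W_(A + v) onto W_A is the free product of the groups of order two
  generated by the conjugates of v under W_A. A torsion element of such a free product is trivial
  or conjugate to a free factor, hence trivial if its length is even. Adding the generators one at
  a time, the square of a torsion element of W is trivial in every W_A.

  If the kernel P is abelian, S_j commutes with its conjugates under the s_i. Let i <= n with s_i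
  not adjacent to s_j. In the infinite dihedral group generated by s_i and s_j this commutation
  forces a_(j,i) = 1, and then S_j has infinite order; with two such indices it fails in the
  symmetric group on four points. If there is no such i, then S_j is a product of commuting
  involutions.
*)
theory Submission
  imports Defs
begin

section \<open>Presented groups\<close>

text \<open>A presentation yields equalities of classes at once, but no inequalities, and no normal
  form for the group is established. That a class is nontrivial, or that two classes differ, is
  always shown by letting the generators act on a set by involutions that commute along the edges,
  and following a point. The sets used are reduced lists, integers, truth values and four permuted
  points. All subgroups on fewer generators stay inside the one group on \<open>S\<close>:
  retraction onto \<open>A\<close> is deletion of the letters outside \<open>A\<close>, so the
  induction on \<open>A\<close> never changes the presentation. Conjugates enter because
  \<open>s_i\<close> itself is not in the kernel when \<open>i\<close> is at most \<open>n\<close>,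
  its image being a basis vector. Conjugating \<open>S_j\<close> by \<open>s_i\<close> stays inside
  and still detects how the two generators interact.\<close>

locale presentation =
  fixes S :: "'a set" and R :: "('a \<times> bool) list set"
  assumes relators_words: "R \<subseteq> words_over S"
begin

abbreviation "cl \<equiv> pres_class S R"
abbreviation "G \<equiv> presented_group S R"
abbreviation "steps \<equiv> (pres_step S R \<union> (pres_step S R)\<inverse>)\<^sup>*"

lemma words_over_Nil [simp]: "[] \<in> words_over S"
  by (simp add: words_over_def)

lemma words_over_append [simp]:
  "u @ w \<in> words_over S \<longleftrightarrow> u \<in> words_over S \<and> w \<in> words_over S"
  by (simp add: words_over_def)

lemma words_over_Cons [simp]:
  "p # w \<in> words_over S \<longleftrightarrow> fst p \<in> S \<and> w \<in> words_over S"
  by (cases p) (simp add: words_over_def)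

lemma steps_sym: "(u, w) \<in> steps \<Longrightarrow> (w, u) \<in> steps"
  by (rule symD[OF sym_rtrancl[OF sym_Un_converse]])

lemma cl_eq_iff: "cl u = cl w \<longleftrightarrow> (u, w) \<in> steps"
proof
  assume "cl u = cl w"
  then have "w \<in> steps `` {u}" by (simp add: pres_class_def)
  then show "(u, w) \<in> steps" by simp
next
  assume uw: "(u, w) \<in> steps"
  have "(u, x) \<in> steps \<longleftrightarrow> (w, x) \<in> steps" for x
    using uw steps_sym[OF uw] by (meson rtrancl_trans)
  then show "cl u = cl w" by (simp add: pres_class_def set_eq_iff)
qed

lemma pres_step_cancel:
  assumes "u \<in> words_over S" "w \<in> words_over S" "x \<in> S"
  shows "(u @ (x, b) # (x, \<not> b) # w, u @ w) \<in> pres_step S R"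
  unfolding pres_step_def
  by (rule UnI1, rule CollectI, rule exI[of _ u], rule exI[of _ x], rule exI[of _ b],
      rule exI[of _ w]) (use assms in simp)

lemma pres_step_relator:
  assumes "u \<in> words_over S" "w \<in> words_over S" "r \<in> R"
  shows "(u @ r @ w, u @ w) \<in> pres_step S R"
  unfolding pres_step_def
  by (rule UnI2, rule CollectI, rule exI[of _ u], rule exI[of _ r], rule exI[of _ w])
    (use assms in simp)

lemma pres_step_cases:
  assumes "(p, q) \<in> pres_step S R"
  obtains (cancel) u x b w where "p = u @ (x, b) # (x, \<not> b) # w" "q = u @ w"
      "u \<in> words_over S" "w \<in> words_over S" "x \<in> S"
  | (relator) u r w where "p = u @ r @ w" "q = u @ w"
      "u \<in> words_over S" "w \<in> words_over S" "r \<in> R"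
  using assms unfolding pres_step_def by auto

lemma steps_words:
  assumes "(u, w) \<in> steps" shows "u \<in> words_over S \<longleftrightarrow> w \<in> words_over S"
proof -
  have *: "p \<in> words_over S \<and> q \<in> words_over S" if "(p, q) \<in> pres_step S R" for p q
    using that relators_words by (cases rule: pres_step_cases) auto
  from assms show ?thesis
    by induction (use * in auto)
qed

lemma pres_step_append:
  assumes "(p, q) \<in> pres_step S R" "u \<in> words_over S" "w \<in> words_over S"
  shows "(u @ p @ w, u @ q @ w) \<in> pres_step S R"
  using assms(1)
proof (cases rule: pres_step_cases)
  case (cancel u' x b w')
  then show ?thesis
    using pres_step_cancel[of "u @ u'" "w' @ w" x b] assms(2,3) by simp
next
  case (relator u' r w')
  then show ?thesis
    using pres_step_relator[of "u @ u'" "w' @ w" r] assms(2,3) by simp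
qed

lemma steps_append:
  assumes "(p, q) \<in> steps" "u \<in> words_over S" "w \<in> words_over S"
  shows "(u @ p @ w, u @ q @ w) \<in> steps"
  using assms(1)
proof induction
  case (step q q')
  then have "(u @ q @ w, u @ q' @ w) \<in> pres_step S R \<union> (pres_step S R)\<inverse>"
    using pres_step_append assms(2,3) by blast
  with step.IH show ?case by (rule rtrancl_into_rtrancl)
qed simp

lemma cl_append_cong:
  assumes "cl u = cl u'" "cl w = cl w'" "u \<in> words_over S" "w \<in> words_over S"
  shows "cl (u @ w) = cl (u' @ w')"
proof -
  have "u' \<in> words_over S"
    using assms steps_words cl_eq_iff by blast
  then have "([] @ u @ w, [] @ u' @ w) \<in> steps" "(u' @ w @ [], u' @ w' @ []) \<in> steps"
    using assms steps_append cl_eq_iff words_over_Nil by blast+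
  then show ?thesis by (auto simp: cl_eq_iff)
qed

lemma mult_cl:
  assumes "u \<in> words_over S" "w \<in> words_over S"
  shows "cl u \<otimes>\<^bsub>G\<^esub> cl w = cl (u @ w)"
proof -
  have "cl (u' @ w') = cl (u @ w)" if "u' \<in> cl u" "w' \<in> cl w" for u' w'
  proof -
    have "cl u = cl u'" "cl w = cl w'"
      using that by (auto simp: pres_class_def cl_eq_iff[unfolded pres_class_def])
    then show ?thesis using cl_append_cong assms by metis
  qed
  moreover have "u \<in> cl u" "w \<in> cl w"
    by (simp_all add: pres_class_def)
  ultimately have "(\<Union>u'\<in>cl u. \<Union>w'\<in>cl w. cl (u' @ w')) = cl (u @ w)"
    by blast
  then show ?thesis
    by (simp add: presented_group_def)
qed

lemma one_G: "\<one>\<^bsub>G\<^esub> = cl []"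
  by (simp add: presented_group_def)

lemma carrier_G: "carrier G = cl ` words_over S"
  by (simp add: presented_group_def)

lemma cl_in_carrier [simp]: "w \<in> words_over S \<Longrightarrow> cl w \<in> carrier G"
  by (simp add: carrier_G)

lemma cl_cancel:
  assumes "x \<in> S" shows "cl [(x, b), (x, \<not> b)] = cl []"
  using pres_step_cancel[of "[]" "[]" x b] assms by (auto simp: cl_eq_iff)

lemma cl_relator:
  assumes "r \<in> R" shows "cl r = cl []"
  using pres_step_relator[of "[]" "[]" r] assms by (auto simp: cl_eq_iff)

lemma cl_left_inverse:
  "w \<in> words_over S \<Longrightarrow> \<exists>w'\<in>words_over S. cl (w' @ w) = cl []"
proof (induction w)
  case (Cons p w)
  obtain x b where p: "p = (x, b)" "x \<in> S" "w \<in> words_over S"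
    using Cons.prems by (cases p) auto
  with Cons.IH obtain w' where w': "w' \<in> words_over S" "cl (w' @ w) = cl []"
    by blast
  have "cl ([(x, \<not> b), p] @ w) = cl ([] @ w)"
    by (rule cl_append_cong) (use p cl_cancel[of x "\<not> b"] in auto)
  then have "cl (w' @ [(x, \<not> b), p] @ w) = cl (w' @ w)"
    by (intro cl_append_cong) (use p w' in auto)
  then show ?case
    using w' p by (intro bexI[of _ "w' @ [(x, \<not> b)]"]) auto
qed auto

lemma group_G: "group G"
proof (rule groupI)
  show "\<exists>y\<in>carrier G. y \<otimes>\<^bsub>G\<^esub> x = \<one>\<^bsub>G\<^esub>" if "x \<in> carrier G" for x
  proof -
    obtain w where w: "w \<in> words_over S" "x = cl w"
      using \<open>x \<in> carrier G\<close> by (auto simp: carrier_G)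
    obtain w' where "w' \<in> words_over S" "cl (w' @ w) = cl []"
      using cl_left_inverse[OF w(1)] by blast
    with w show ?thesis
      by (intro bexI[of _ "cl w'"]) (auto simp: one_G mult_cl)
  qed
qed (auto simp: carrier_G one_G mult_cl)

sublocale group G by (rule group_G)

lemma cl_power:
  assumes "w \<in> words_over S"
  shows "cl w [^]\<^bsub>G\<^esub> k = cl (concat (replicate k w))"
    and "concat (replicate k w) \<in> words_over S"
proof -
  show *: "concat (replicate k w) \<in> words_over S" for k
    by (induction k) (use assms in auto)
  show "cl w [^]\<^bsub>G\<^esub> k = cl (concat (replicate k w))"
  proof (induction k)
    case (Suc k)
    have "concat (replicate (Suc k) w) = concat (replicate k w) @ w"
      by (simp flip: replicate_append_same)
    with Suc assms * show ?case by (simp add: mult_cl)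
  qed (simp add: one_G)
qed

text \<open>Checking single rewriting steps suffices, since classes are generated by them. Every
  separation of two classes rests on this.\<close>

lemma cl_invariant:
  assumes "\<And>p q. (p, q) \<in> pres_step S R \<Longrightarrow> F p = F q" and "cl u = cl w"
  shows "F u = F w"
proof -
  have "(u, w) \<in> steps" using assms(2) by (simp add: cl_eq_iff)
  then show ?thesis
    by induction (use assms(1) in auto)
qed

end


section \<open>Right-angled Coxeter groups\<close>

text \<open>The exponent flag is ignored: only involutions are used as \<open>f a\<close>, so a
  generator and its inverse act alike.\<close>

definition word_act :: "('a \<Rightarrow> 'x \<Rightarrow> 'x) \<Rightarrow> ('a \<times> bool) list \<Rightarrow> 'x \<Rightarrow> 'x" where
  "word_act f w x = foldr (\<lambda>(a, b). f a) w x"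

lemma word_act_Nil [simp]: "word_act f [] x = x"
  and word_act_Cons [simp]: "word_act f ((a, b) # w) x = f a (word_act f w x)"
  and word_act_append [simp]: "word_act f (u @ w) x = word_act f u (word_act f w x)"
  by (auto simp: word_act_def)

lemma word_act_concat_replicate:
  "word_act f (concat (replicate k w)) x = (word_act f w ^^ k) x"
  by (induction k) auto

text \<open>This is the shape of \<open>W_relators\<close> with the cone condition abstracted to
  \<open>E\<close>. The case \<open>i = j\<close> is allowed and only adds the fourth power of a
  generator.\<close>

definition racg_relators :: "'a set \<Rightarrow> ('a \<Rightarrow> 'a \<Rightarrow> bool) \<Rightarrow> ('a \<times> bool) list set" where
  "racg_relators S E =
     {[(j, True), (j, True)] | j. j \<in> S} \<union>
     {[(i, True), (j, True), (i, True), (j, True)] | i j. i \<in> S \<and> j \<in> S \<and> E i j}"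

locale racg =
  fixes S :: "'a set" and E :: "'a \<Rightarrow> 'a \<Rightarrow> bool"

sublocale racg \<subseteq> presentation S "racg_relators S E"
  by unfold_locales (auto simp: racg_relators_def words_over_def)

context racg
begin

definition gen :: "'a \<Rightarrow> ('a \<times> bool) list set" where
  "gen a = cl [(a, True)]"

lemma gen_closed [simp]: "a \<in> S \<Longrightarrow> gen a \<in> carrier G"
  by (simp add: gen_def)

lemma gen_square: "a \<in> S \<Longrightarrow> gen a \<otimes>\<^bsub>G\<^esub> gen a = \<one>\<^bsub>G\<^esub>"
  by (simp add: gen_def mult_cl one_G) (rule cl_relator, auto simp: racg_relators_def)

lemma inv_gen: "a \<in> S \<Longrightarrow> inv\<^bsub>G\<^esub> gen a = gen a"
  by (intro inv_equality gen_square gen_closed)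

lemma cl_letter: "a \<in> S \<Longrightarrow> cl [(a, b)] = gen a"
proof (cases b)
  case False
  assume a: "a \<in> S"
  have "cl [(a, False)] \<otimes>\<^bsub>G\<^esub> gen a = \<one>\<^bsub>G\<^esub>"
    using a cl_cancel[of a False] by (simp add: gen_def mult_cl one_G)
  then have "inv\<^bsub>G\<^esub> gen a = cl [(a, False)]"
    using a by (intro inv_equality) auto
  with False a show ?thesis by (simp add: inv_gen)
qed (simp add: gen_def)

lemma cl_Cons:
  "a \<in> S \<Longrightarrow> w \<in> words_over S \<Longrightarrow> cl ((a, b) # w) = gen a \<otimes>\<^bsub>G\<^esub> cl w"
  using mult_cl[of "[(a, b)]" w] by (simp add: cl_letter)

lemma gen_commute:
  assumes "a \<in> S" "b \<in> S" "E a b"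
  shows "gen a \<otimes>\<^bsub>G\<^esub> gen b = gen b \<otimes>\<^bsub>G\<^esub> gen a"
proof -
  have "(gen a \<otimes>\<^bsub>G\<^esub> gen b) \<otimes>\<^bsub>G\<^esub> (gen a \<otimes>\<^bsub>G\<^esub> gen b) = \<one>\<^bsub>G\<^esub>"
    using assms
    by (simp add: gen_def mult_cl one_G) (rule cl_relator, auto simp: racg_relators_def)
  then have "inv\<^bsub>G\<^esub> (gen a \<otimes>\<^bsub>G\<^esub> gen b) = gen a \<otimes>\<^bsub>G\<^esub> gen b"
    using assms by (intro inv_equality) auto
  then show ?thesis
    using assms by (simp add: inv_mult_group inv_gen)
qed

text \<open>Commuting involutions satisfy all relators. The invariant set \<open>X\<close> is there
  because \<open>toggle\<close> is an involution only on lists without equal neighbours.\<close>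

lemma word_act_cong:
  assumes maps: "\<And>a x. a \<in> S \<Longrightarrow> x \<in> X \<Longrightarrow> f a x \<in> X"
    and invol: "\<And>a x. a \<in> S \<Longrightarrow> x \<in> X \<Longrightarrow> f a (f a x) = x"
    and commute: "\<And>a b x. a \<in> S \<Longrightarrow> b \<in> S \<Longrightarrow> E a b \<Longrightarrow> x \<in> X \<Longrightarrow> f a (f b x) = f b (f a x)"
    and "cl u = cl w" "x \<in> X"
  shows "word_act f u x = word_act f w x"
proof (rule cl_invariant[OF _ \<open>cl u = cl w\<close>])
  fix p q
  assume "(p, q) \<in> pres_step S (racg_relators S E)"
  moreover have "word_act f w x \<in> X" if "w \<in> words_over S" for w
    using that by (induction w) (auto simp: maps \<open>x \<in> X\<close>)
  moreover have "f i (f j (f i (f j y))) = y" if "i \<in> S" "j \<in> S" "E i j" "y \<in> X" for i j y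
    using that commute[of i j y] by (simp add: maps invol)
  ultimately show "word_act f p x = word_act f q x"
    by (cases rule: pres_step_cases) (auto simp: racg_relators_def maps invol)
qed

end


section \<open>Reduced words in a free product of groups of order two\<close>

text \<open>
  Lists without equal neighbours are the reduced words in the free product of copies of
  \<open>\<int>/2\<close>; \<open>toggle a\<close> is left multiplication by the generator \<open>a\<close>.
\<close>

fun toggle :: "'a \<Rightarrow> 'a list \<Rightarrow> 'a list" where
  "toggle a [] = [a]"
| "toggle a (b # xs) = (if a = b then xs else a # b # xs)"

lemma distinct_adj_toggle [simp]: "distinct_adj xs \<Longrightarrow> distinct_adj (toggle a xs)"
  by (cases xs) (auto simp: distinct_adj_Cons)

lemma toggle_toggle [simp]: "distinct_adj xs \<Longrightarrow> toggle a (toggle a xs) = xs"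
  by (cases xs rule: remdups_adj.cases) auto

lemma set_toggle_subset: "set (toggle a xs) \<subseteq> insert a (set xs)"
  by (cases xs) auto

lemma even_length_toggle [simp]: "even (length (toggle a xs)) \<longleftrightarrow> odd (length xs)"
  by (cases xs) auto

lemma map_toggle:
  "inj_on f (insert a (set xs)) \<Longrightarrow> map f (toggle a xs) = toggle (f a) (map f xs)"
  by (cases xs) (auto simp: inj_on_def)

lemma distinct_adj_foldr_toggle [simp]:
  "distinct_adj ys \<Longrightarrow> distinct_adj (foldr toggle xs ys)"
  by (induction xs) auto

lemma set_foldr_toggle_subset: "set (foldr toggle xs ys) \<subseteq> set xs \<union> set ys"
proof (induction xs)
  case (Cons x xs)
  then show ?case using set_toggle_subset[of x "foldr toggle xs ys"] by auto
qed simp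

text \<open>If \<open>a\<close> cancels the head of \<open>xs\<close>, the two toggles by
  \<open>a\<close> on the right cancel as well. This is associativity for products of reduced
  words.\<close>

lemma foldr_toggle_toggle:
  "distinct_adj ys \<Longrightarrow> foldr toggle (toggle a xs) ys = toggle a (foldr toggle xs ys)"
  by (cases xs) auto

lemma map_foldr_toggle:
  "inj_on f (set xs \<union> set ys) \<Longrightarrow>
    map f (foldr toggle xs ys) = foldr toggle (map f xs) (map f ys)"
proof (induction xs)
  case (Cons x xs)
  have "map f (toggle x (foldr toggle xs ys)) = toggle (f x) (map f (foldr toggle xs ys))"
    using set_foldr_toggle_subset[of xs ys] by (intro map_toggle inj_on_subset[OF Cons.prems]) auto
  moreover have "inj_on f (set xs \<union> set ys)"
    by (rule inj_on_subset[OF Cons.prems]) auto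
  ultimately show ?case using Cons.IH by simp
qed simp

lemma foldr_toggle_reduced: "distinct_adj (xs @ ys) \<Longrightarrow> foldr toggle xs ys = xs @ ys"
proof (induction xs)
  case (Cons x xs)
  then have "foldr toggle xs ys = xs @ ys"
    by (auto simp: distinct_adj_Cons)
  with Cons.prems show ?case by (cases "xs @ ys") auto
qed simp

text \<open>Conjugating by an outer letter that occurs at both ends shortens the word by two, until
  it is cyclically reduced; then its powers do not cancel. Even length excludes ending at a single
  letter, which would have order two. The alphabet \<open>C\<close> bounds the lists on which
  torsion has to be known.\<close>

lemma reduced_even_torsion_Nil:
  assumes "distinct_adj cs" "even (length cs)" "set cs \<subseteq> C" "0 < k"
    and "\<And>xs. distinct_adj xs \<Longrightarrow> set xs \<subseteq> C \<Longrightarrow> (foldr toggle cs ^^ k) xs = xs"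
  shows "cs = []"
  using assms(1-3,5)
proof (induction cs rule: length_induct)
  case (1 cs)
  note cs = 1(2-5) and IH = 1(1)
  show ?case
  proof (rule ccontr)
    assume "cs \<noteq> []"
    then obtain a t where t: "cs = a # t" by (cases cs) auto
    with cs(2) obtain ys b where "t = ys @ [b]"
      by (cases t rule: rev_cases) auto
    with t have eq: "cs = a # ys @ [b]" by simp
    show False
    proof (cases "a = b")
      case False
      have last_cs: "last cs = b" by (simp add: eq)
      \<comment> \<open>Since the last letter \<open>b\<close> differs from the first letter
        \<open>a\<close>, nothing cancels where copies of \<open>cs\<close> meet.\<close>
      have "distinct_adj (concat (replicate m cs)) \<and>
          (foldr toggle cs ^^ m) [] = concat (replicate m cs)" for m
      proof (induction m)
        case (Suc m)
        have "concat (replicate m cs) = [] \<or> hd (concat (replicate m cs)) = a"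
          by (cases m) (auto simp: eq)
        with Suc cs(1) False have "distinct_adj (cs @ concat (replicate m cs))"
          by (subst distinct_adj_append_iff) (auto simp: last_cs)
        with Suc show ?case by (simp add: foldr_toggle_reduced)
      qed simp
      from this[of k] cs(4)[of "[]"] have "concat (replicate k cs) = []" by simp
      with \<open>0 < k\<close> \<open>cs \<noteq> []\<close> show False by (cases k) auto
    next
      case True
      \<comment> \<open>Here \<open>cs\<close> acts as the conjugate of \<open>ys\<close> by the
        involution \<open>toggle a\<close>, so the inner toggles cancel in every power.\<close>
      have conj: "(foldr toggle cs ^^ m) xs = toggle a ((foldr toggle ys ^^ m) (toggle a xs)) \<and>
          distinct_adj ((foldr toggle ys ^^ m) (toggle a xs))" if "distinct_adj xs" for m xs
        by (induction m) (use that in \<open>auto simp: eq True\<close>)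
      have "(foldr toggle ys ^^ k) xs = xs" if "distinct_adj xs" "set xs \<subseteq> C" for xs
      proof -
        have "set (toggle a xs) \<subseteq> C"
          using set_toggle_subset[of a xs] that cs(3) eq by auto
        then have "toggle a ((foldr toggle ys ^^ k) xs) = toggle a xs"
          and "distinct_adj ((foldr toggle ys ^^ k) xs)"
          using conj[of "toggle a xs" k] cs(4)[of "toggle a xs"] that by auto
        then show ?thesis using that by (metis toggle_toggle)
      qed
      moreover have "distinct_adj ys" "even (length ys)" "set ys \<subseteq> C"
        using cs(1-3) by (auto simp: eq distinct_adj_append_iff distinct_adj_Cons)
      ultimately have "ys = []" using IH eq by auto
      with cs(1) eq True show False by simp
    qed
  qed
qed


section \<open>Torsion in right-angled Coxeter groups\<close>

context racg
begin

abbreviation restrict_word :: "'a set \<Rightarrow> ('a \<times> bool) list \<Rightarrow> ('a \<times> bool) list" where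
  "restrict_word A \<equiv> filter (\<lambda>p. fst p \<in> A)"

lemma filter_words [simp]: "w \<in> words_over S \<Longrightarrow> filter P w \<in> words_over S"
  by (induction w) auto

section \<open>Conjugation as a renaming of letters in reduced words\<close>

definition conj_by :: "('a \<times> bool) list set \<Rightarrow> ('a \<times> bool) list set \<Rightarrow> ('a \<times> bool) list set" where
  "conj_by g x = g \<otimes>\<^bsub>G\<^esub> x \<otimes>\<^bsub>G\<^esub> inv\<^bsub>G\<^esub> g"

lemma conj_by_closed [simp]: "g \<in> carrier G \<Longrightarrow> x \<in> carrier G \<Longrightarrow> conj_by g x \<in> carrier G"
  by (simp add: conj_by_def)

lemma conj_by_one [simp]: "x \<in> carrier G \<Longrightarrow> conj_by \<one>\<^bsub>G\<^esub> x = x"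
  by (simp add: conj_by_def)

lemma conj_by_mult:
  assumes "g \<in> carrier G" "x \<in> carrier G" "y \<in> carrier G"
  shows "conj_by g (x \<otimes>\<^bsub>G\<^esub> y) = conj_by g x \<otimes>\<^bsub>G\<^esub> conj_by g y"
proof -
  have "inv\<^bsub>G\<^esub> g \<otimes>\<^bsub>G\<^esub> (g \<otimes>\<^bsub>G\<^esub> (y \<otimes>\<^bsub>G\<^esub> inv\<^bsub>G\<^esub> g)) = y \<otimes>\<^bsub>G\<^esub> inv\<^bsub>G\<^esub> g"
    using assms by (simp flip: m_assoc)
  with assms show ?thesis by (simp add: conj_by_def m_assoc)
qed

lemma conj_by_conj_by:
  "g \<in> carrier G \<Longrightarrow> h \<in> carrier G \<Longrightarrow> x \<in> carrier G \<Longrightarrow>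
    conj_by g (conj_by h x) = conj_by (g \<otimes>\<^bsub>G\<^esub> h) x"
  by (simp add: conj_by_def m_assoc inv_mult_group)

lemma inj_on_conj_by: "g \<in> carrier G \<Longrightarrow> inj_on (conj_by g) (carrier G)"
  by (auto simp: inj_on_def conj_by_def)

text \<open>This handles the relators linking the new generator to \<open>A\<close>: renaming by a
  neighbour fixes the letter that is toggled.\<close>

lemma conj_by_gen_fixes:
  assumes "a \<in> S" "b \<in> S" "E a b \<or> E b a"
  shows "conj_by (gen a) (gen b) = gen b"
proof -
  have "gen a \<otimes>\<^bsub>G\<^esub> gen b = gen b \<otimes>\<^bsub>G\<^esub> gen a"
    using assms gen_commute by metis
  with assms show ?thesis
    by (simp add: conj_by_def m_assoc r_inv)
qed

text \<open>Any group element may be a letter, not only a conjugate of the new generator. The set is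
  thus the same for all \<open>A\<close> and \<open>v\<close>, and plainly closed under
  renaming.\<close>

definition reduced_lists :: "('a \<times> bool) list set list set" where
  "reduced_lists = {xs. distinct_adj xs \<and> set xs \<subseteq> carrier G}"

lemma map_conj_by_reduced:
  assumes "g \<in> carrier G" "xs \<in> reduced_lists"
  shows "map (conj_by g) xs \<in> reduced_lists"
proof -
  have "inj_on (conj_by g) (set xs)"
    using assms inj_on_subset[OF inj_on_conj_by] by (auto simp: reduced_lists_def)
  then show ?thesis
    using assms by (auto simp: reduced_lists_def intro: distinct_adj_mapI)
qed

lemma toggle_reduced:
  "g \<in> carrier G \<Longrightarrow> xs \<in> reduced_lists \<Longrightarrow> toggle g xs \<in> reduced_lists"
  using set_toggle_subset[of g xs] by (auto simp: reduced_lists_def)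

lemma map_conj_by_toggle:
  assumes "g \<in> carrier G" "h \<in> carrier G" "xs \<in> reduced_lists"
  shows "map (conj_by g) (toggle h xs) = toggle (conj_by g h) (map (conj_by g) xs)"
  using assms by (intro map_toggle inj_on_subset[OF inj_on_conj_by]) (auto simp: reduced_lists_def)

lemma map_conj_by_map_conj_by:
  assumes "g \<in> carrier G" "h \<in> carrier G" "xs \<in> reduced_lists"
  shows "map (conj_by g) (map (conj_by h) xs) = map (conj_by (g \<otimes>\<^bsub>G\<^esub> h)) xs"
  using assms by (auto simp: reduced_lists_def conj_by_conj_by)

lemma map_conj_by_one: "xs \<in> reduced_lists \<Longrightarrow> map (conj_by \<one>\<^bsub>G\<^esub>) xs = xs"
  by (rule map_idI) (auto simp: reduced_lists_def)

text \<open>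
  The kernel of the retraction \<open>W\<^bsub>A \<union> {v}\<^esub> \<rightarrow> W\<^bsub>A\<^esub>\<close> is the free product of the groups of order two
  generated by the conjugates of \<open>v\<close> under \<open>W\<^bsub>A\<^esub>\<close>. The following is the action of the semidirect
  product \<open>W\<^bsub>A \<union> {v}\<^esub>\<close> on reduced words in these conjugates.
\<close>

definition kernel_act ::
  "'a set \<Rightarrow> 'a \<Rightarrow> 'a \<Rightarrow> ('a \<times> bool) list set list \<Rightarrow> ('a \<times> bool) list set list" where
  "kernel_act A v a xs =
     (if a = v then toggle (gen v) xs else if a \<in> A then map (conj_by (gen a)) xs else xs)"

lemma kernel_act_reduced:
  "a \<in> S \<Longrightarrow> xs \<in> reduced_lists \<Longrightarrow> kernel_act A v a xs \<in> reduced_lists"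
  by (auto simp: kernel_act_def toggle_reduced map_conj_by_reduced)

lemma kernel_act_cong:
  assumes "cl u = cl w" "xs \<in> reduced_lists"
  shows "word_act (kernel_act A v) u xs = word_act (kernel_act A v) w xs"
proof (rule word_act_cong[where X = reduced_lists, OF kernel_act_reduced _ _ assms])
  fix a xs
  assume "a \<in> S" "xs \<in> reduced_lists"
  then show "kernel_act A v a (kernel_act A v a xs) = xs"
    using map_conj_by_map_conj_by[of "gen a" "gen a" xs] map_conj_by_one[of xs]
    by (auto simp: kernel_act_def gen_square reduced_lists_def simp del: map_map)
next
  fix a b xs
  assume *: "a \<in> S" "b \<in> S" "E a b" "xs \<in> reduced_lists"
  have "map (conj_by (gen a)) (map (conj_by (gen b)) xs) =
      map (conj_by (gen b)) (map (conj_by (gen a)) xs)"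
    using * gen_commute[of a b] by (simp add: map_conj_by_map_conj_by del: map_map)
  with * show "kernel_act A v a (kernel_act A v b xs) = kernel_act A v b (kernel_act A v a xs)"
    by (auto simp: kernel_act_def map_conj_by_toggle conj_by_gen_fixes simp del: map_map)
qed

lemma word_act_kernel_reduced:
  "w \<in> words_over S \<Longrightarrow> xs \<in> reduced_lists \<Longrightarrow>
    word_act (kernel_act A v) w xs \<in> reduced_lists"
  by (induction w) (auto simp: kernel_act_reduced)

text \<open>Renaming keeps the length and each toggle changes it by one, so only occurrences of
  \<open>v\<close> affect the parity.\<close>

lemma even_length_word_act_kernel:
  "even (length (word_act (kernel_act A v) w xs)) \<longleftrightarrow>
    (even (length xs) \<longleftrightarrow> even (length (restrict_word {v} w)))"
proof (induction w)
  case (Cons p w)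
  then show ?case by (cases p) (auto simp: kernel_act_def)
qed simp

section \<open>Kernel and complement components of a word\<close>

abbreviation list_prod :: "('a \<times> bool) list set list \<Rightarrow> ('a \<times> bool) list set" where
  "list_prod xs \<equiv> foldr (\<lambda>x y. x \<otimes>\<^bsub>G\<^esub> y) xs \<one>\<^bsub>G\<^esub>"

lemma list_prod_closed: "set xs \<subseteq> carrier G \<Longrightarrow> list_prod xs \<in> carrier G"
  by (induction xs) auto

lemma list_prod_toggle_gen:
  assumes "v \<in> S" "set xs \<subseteq> carrier G"
  shows "list_prod (toggle (gen v) xs) = gen v \<otimes>\<^bsub>G\<^esub> list_prod xs"
  using assms gen_square[of v] list_prod_closed[of "tl xs"]
  by (cases xs) (auto simp flip: m_assoc)

lemma list_prod_map_conj_by: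
  assumes "g \<in> carrier G" "set xs \<subseteq> carrier G"
  shows "list_prod (map (conj_by g) xs) = conj_by g (list_prod xs)"
  using assms(2)
proof (induction xs)
  case (Cons x xs)
  then have "list_prod xs \<in> carrier G" by (auto intro: list_prod_closed)
  with Cons assms(1) show ?case
    by (simp add: conj_by_mult)
qed (use assms(1) in \<open>simp add: conj_by_def r_inv\<close>)

text \<open>This is the semidirect decomposition: the list reached from \<open>[]\<close> is the
  kernel component, and \<open>list_prod\<close> evaluates it in the group. Prepending
  \<open>v\<close> multiplies that component; prepending a letter of \<open>A\<close> conjugates it
  and multiplies the complement.\<close>

lemma list_prod_word_act_kernel:
  assumes "v \<in> S" "v \<notin> A" "w \<in> words_over S"
  shows "list_prod (word_act (kernel_act A v) w []) \<otimes>\<^bsub>G\<^esub> cl (restrict_word A w) =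
    cl (restrict_word (insert v A) w)"
  using assms(3)
proof (induction w)
  case (Cons p w)
  obtain a b where p: "p = (a, b)" "a \<in> S" "w \<in> words_over S"
    using Cons.prems by (cases p) auto
  define cs where "cs = word_act (kernel_act A v) w []"
  have cs: "set cs \<subseteq> carrier G"
    using word_act_kernel_reduced[OF p(3), of "[]"] by (auto simp: reduced_lists_def cs_def)
  note closed = list_prod_closed[OF cs]
  have IH: "list_prod cs \<otimes>\<^bsub>G\<^esub> cl (restrict_word A w) = cl (restrict_word (insert v A) w)"
    using Cons.IH p by (simp add: cs_def)
  consider "a = v" | "a \<noteq> v" "a \<in> A" | "a \<noteq> v" "a \<notin> A" by blast
  then have "list_prod (kernel_act A v a cs) \<otimes>\<^bsub>G\<^esub> cl (restrict_word A (p # w)) =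
      cl (restrict_word (insert v A) (p # w))"
  proof cases
    case 1
    then show ?thesis
      using p assms closed cs IH
      by (simp add: kernel_act_def list_prod_toggle_gen cl_Cons m_assoc)
  next
    case 2
    have "inv\<^bsub>G\<^esub> gen a \<otimes>\<^bsub>G\<^esub> (gen a \<otimes>\<^bsub>G\<^esub> cl (restrict_word A w)) = cl (restrict_word A w)"
      using p by (simp flip: m_assoc)
    with 2 show ?thesis
      using p assms closed cs IH
      by (simp add: kernel_act_def list_prod_map_conj_by conj_by_def cl_Cons m_assoc)
  next
    case 3
    then show ?thesis using p IH by (simp add: kernel_act_def)
  qed
  then show ?case by (simp add: p(1) cs_def)
qed (simp add: one_G mult_cl)

text \<open>The complement component acts by conjugation, then the kernel component by left
  multiplication. Hence a word with trivial \<open>A\<close>-part acts purely by left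
  multiplication.\<close>

lemma word_act_kernel_eq:
  assumes "v \<in> S" "v \<notin> A" "w \<in> words_over S" "xs \<in> reduced_lists"
  shows "word_act (kernel_act A v) w xs =
    foldr toggle (word_act (kernel_act A v) w []) (map (conj_by (cl (restrict_word A w))) xs)"
  using assms(3)
proof (induction w)
  case Nil
  then show ?case using map_conj_by_one[OF assms(4)] by (simp add: one_G)
next
  case (Cons p w)
  obtain a b where p: "p = (a, b)" "a \<in> S" "w \<in> words_over S"
    using Cons.prems by (cases p) auto
  define cs where "cs = word_act (kernel_act A v) w []"
  define ys where "ys = map (conj_by (cl (restrict_word A w))) xs"
  have cs: "cs \<in> reduced_lists"
    using word_act_kernel_reduced[OF p(3), of "[]"] by (auto simp: reduced_lists_def cs_def)
  have ys: "ys \<in> reduced_lists"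
    using p assms(4) by (simp add: ys_def map_conj_by_reduced)
  have IH: "word_act (kernel_act A v) w xs = foldr toggle cs ys"
    using Cons.IH p by (simp add: cs_def ys_def)
  consider "a = v" | "a \<noteq> v" "a \<in> A" | "a \<noteq> v" "a \<notin> A" by blast
  then have "kernel_act A v a (foldr toggle cs ys) = foldr toggle (kernel_act A v a cs)
      (map (conj_by (cl (restrict_word A (p # w)))) xs)"
  proof cases
    case 1
    then show ?thesis
      using p assms(2) ys by (simp add: kernel_act_def foldr_toggle_toggle reduced_lists_def
        flip: ys_def)
  next
    case 2
    have "map (conj_by (gen a)) ys = map (conj_by (cl (restrict_word A (p # w)))) xs"
      using 2 p assms(4) by (simp add: ys_def map_conj_by_map_conj_by cl_Cons del: map_map)
    moreover have "inj_on (conj_by (gen a)) (set cs \<union> set ys)"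
      using cs ys p by (intro inj_on_subset[OF inj_on_conj_by]) (auto simp: reduced_lists_def)
    ultimately show ?thesis
      using 2 by (simp add: kernel_act_def map_foldr_toggle)
  next
    case 3
    then show ?thesis using p by (simp add: kernel_act_def flip: ys_def)
  qed
  then show ?case using IH by (simp add: p(1) cs_def)
qed

text \<open>
  If \<open>g\<close> is torsion then its image in \<open>W\<^bsub>A\<^esub>\<close> squares to one by induction, so the image of \<open>g\<^sup>2\<close>
  in \<open>W\<^bsub>A \<union> {v}\<^esub>\<close> is a torsion element of the free product above. It has even length because the
  letter \<open>v\<close> occurs an even number of times in \<open>w @ w\<close>, whereas nontrivial torsion elements of the
  free product are conjugate to letters.
\<close>

lemma torsion_restrict_square:
  assumes "finite A" "A \<subseteq> S" "w \<in> words_over S" "0 < (k :: nat)"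
    and torsion: "cl w [^]\<^bsub>G\<^esub> k = \<one>\<^bsub>G\<^esub>"
  shows "cl (restrict_word A (w @ w)) = \<one>\<^bsub>G\<^esub>"
  using assms(1,2)
proof (induction A)
  case empty
  then show ?case by (simp add: one_G)
next
  case (insert v A)
  define cs where "cs = word_act (kernel_act A v) (w @ w) []"
  have nil: "[] \<in> reduced_lists" by (simp add: reduced_lists_def)
  have ww: "w @ w \<in> words_over S" using assms(3) by simp
  have IH: "cl (restrict_word A (w @ w)) = \<one>\<^bsub>G\<^esub>" using insert by auto
  have cs: "cs \<in> reduced_lists"
    unfolding cs_def by (rule word_act_kernel_reduced[OF ww nil])
  have act: "word_act (kernel_act A v) (w @ w) xs = foldr toggle cs xs"
    if "xs \<in> reduced_lists" for xs
    using word_act_kernel_eq[OF _ _ ww that, of v A] insert.hyps insert.prems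
      map_conj_by_one[OF that] by (simp only: IH cs_def) simp
  have "cl (w @ w) [^]\<^bsub>G\<^esub> k = (cl w [^]\<^bsub>G\<^esub> (2::nat)) [^]\<^bsub>G\<^esub> k"
    using assms(3) by (simp add: mult_cl numeral_2_eq_2)
  also have "\<dots> = (cl w [^]\<^bsub>G\<^esub> k) [^]\<^bsub>G\<^esub> (2::nat)"
    using assms(3) by (simp add: nat_pow_pow mult.commute)
  finally have "cl (concat (replicate k (w @ w))) = cl []"
    using torsion cl_power(1)[OF ww] by (simp add: one_G[symmetric])
  then have "(word_act (kernel_act A v) (w @ w) ^^ k) xs = xs" if "xs \<in> reduced_lists" for xs
    using kernel_act_cong[OF _ that] word_act_concat_replicate word_act_Nil by metis
  moreover have "(word_act (kernel_act A v) (w @ w) ^^ m) xs = (foldr toggle cs ^^ m) xs \<and>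
      (foldr toggle cs ^^ m) xs \<in> reduced_lists" if "xs \<in> reduced_lists" for m xs
  proof (induction m)
    case (Suc m)
    then show ?case using act word_act_kernel_reduced[OF ww] by (metis comp_apply funpow.simps(2))
  qed (use that in simp)
  ultimately have "(foldr toggle cs ^^ k) xs = xs" if "xs \<in> reduced_lists" for xs
    using that by metis
  moreover have "even (length cs)"
    by (simp only: cs_def even_length_word_act_kernel) simp
  ultimately have "cs = []"
    using cs \<open>0 < k\<close> by (intro reduced_even_torsion_Nil[where C = "carrier G"])
      (auto simp: reduced_lists_def)
  \<comment> \<open>With an empty kernel component and a trivial \<open>A\<close>-component, the
    decomposition leaves the identity.\<close>
  then show ?case
    using list_prod_word_act_kernel[OF _ _ ww, of v A] insert.hyps insert.prems IH
    by (simp add: cs_def)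
qed

theorem torsion_square:
  assumes "finite S" "g \<in> carrier G" "0 < (k :: nat)" "g [^]\<^bsub>G\<^esub> k = \<one>\<^bsub>G\<^esub>"
  shows "g \<otimes>\<^bsub>G\<^esub> g = \<one>\<^bsub>G\<^esub>"
proof -
  obtain w where w: "w \<in> words_over S" "g = cl w"
    using assms(2) by (auto simp: carrier_G)
  have "restrict_word S (w @ w) = w @ w"
    using w(1) by (intro filter_True) (auto simp: words_over_def)
  with w assms torsion_restrict_square[of S w k] show ?thesis
    by (simp add: mult_cl)
qed

end

section \<open>Square elements and non-adjacent generators\<close>

definition letters :: "'a list \<Rightarrow> ('a \<times> bool) list" where
  "letters = map (\<lambda>a. (a, True))"

lemma letters_Nil [simp]: "letters [] = []"
  and letters_Cons [simp]: "letters (a # xs) = (a, True) # letters xs"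
  by (simp_all add: letters_def)

lemma word_act_letters: "word_act f (letters xs) x = foldr f xs x"
  by (induction xs) auto

text \<open>When all letters but \<open>i\<close> and \<open>i'\<close> act trivially, commutation
  makes the order of these two in \<open>xs\<close> immaterial.\<close>

lemma foldr_two_active:
  assumes "distinct xs" "\<And>a. a \<in> set xs \<Longrightarrow> a \<noteq> i \<Longrightarrow> a \<noteq> i' \<Longrightarrow> f a = id"
    and "\<And>x. f i (f i' x) = f i' (f i x)" "i \<noteq> i'"
  shows "foldr f xs x = (if i \<in> set xs then f i else id) ((if i' \<in> set xs then f i' else id) x)"
  using assms(1,2)
proof (induction xs)
  case (Cons a xs)
  then have "foldr f xs x =
      (if i \<in> set xs then f i else id) ((if i' \<in> set xs then f i' else id) x)"
    by simp
  moreover have "a = i \<or> a = i' \<or> f a = id"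
    using Cons.prems(2)[of a] by (meson list.set_intros(1))
  ultimately show ?case
    using Cons.prems(1) assms(3,4) by (elim disjE) simp_all
qed simp

lemma foldr_one_active:
  assumes "distinct xs" "\<And>a. a \<in> set xs \<Longrightarrow> a \<noteq> i \<Longrightarrow> f a = id"
  shows "foldr f xs x = (if i \<in> set xs then f i x else x)"
  using assms
proof (induction xs)
  case (Cons a xs)
  then have "foldr f xs x = (if i \<in> set xs then f i x else x)"
    by simp
  moreover have "a = i \<or> f a = id"
    using Cons.prems(2)[of a] by (meson list.set_intros(1))
  ultimately show ?case
    using Cons.prems(1) by (elim disjE) simp_all
qed simp

context racg
begin

lemma letters_words [simp]: "letters xs \<in> words_over S \<longleftrightarrow> set xs \<subseteq> S"
  by (induction xs) auto

lemma cl_letters_Cons: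
  "a \<in> S \<Longrightarrow> set xs \<subseteq> S \<Longrightarrow> cl (letters (a # xs)) = gen a \<otimes>\<^bsub>G\<^esub> cl (letters xs)"
  by (simp add: cl_Cons)

lemma gen_commute_letters:
  assumes "a \<in> S" "set xs \<subseteq> S" "\<forall>b\<in>set xs. E a b"
  shows "gen a \<otimes>\<^bsub>G\<^esub> cl (letters xs) = cl (letters xs) \<otimes>\<^bsub>G\<^esub> gen a"
  using assms(2,3)
proof (induction xs)
  case (Cons b xs)
  have "gen a \<otimes>\<^bsub>G\<^esub> (gen b \<otimes>\<^bsub>G\<^esub> cl (letters xs)) = gen b \<otimes>\<^bsub>G\<^esub> (gen a \<otimes>\<^bsub>G\<^esub> cl (letters xs))"
    using Cons.prems assms(1) gen_commute[of a b] by (simp flip: m_assoc)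
  with Cons assms(1) show ?case by (simp add: cl_Cons m_assoc)
qed (use assms(1) in \<open>simp flip: one_G\<close>)

lemma letters_square:
  assumes "set xs \<subseteq> S" "distinct xs" "\<forall>a\<in>set xs. \<forall>b\<in>set xs. a \<noteq> b \<longrightarrow> E a b"
  shows "cl (letters xs) \<otimes>\<^bsub>G\<^esub> cl (letters xs) = \<one>\<^bsub>G\<^esub>"
  using assms
proof (induction xs)
  case (Cons a xs)
  define s where "s = cl (letters xs)"
  have "\<forall>b\<in>set xs. E a b" using Cons.prems by auto
  then have s: "s \<in> carrier G" "gen a \<otimes>\<^bsub>G\<^esub> s = s \<otimes>\<^bsub>G\<^esub> gen a" "s \<otimes>\<^bsub>G\<^esub> s = \<one>\<^bsub>G\<^esub>"
    using Cons gen_commute_letters[of a xs] by (simp_all add: s_def)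
  have a: "gen a \<in> carrier G" using Cons.prems by simp
  have "(gen a \<otimes>\<^bsub>G\<^esub> s) \<otimes>\<^bsub>G\<^esub> (gen a \<otimes>\<^bsub>G\<^esub> s) = (gen a \<otimes>\<^bsub>G\<^esub> s) \<otimes>\<^bsub>G\<^esub> (s \<otimes>\<^bsub>G\<^esub> gen a)"
    using s(2) by simp
  also have "\<dots> = gen a \<otimes>\<^bsub>G\<^esub> (s \<otimes>\<^bsub>G\<^esub> s) \<otimes>\<^bsub>G\<^esub> gen a"
    using s(1) a by (simp add: m_assoc)
  also have "\<dots> = \<one>\<^bsub>G\<^esub>"
    using s a gen_square[of a] Cons.prems by simp
  finally show ?case using Cons.prems by (simp add: cl_Cons s_def)
qed (simp flip: one_G)

lemma cl_conj_gen:
  "i \<in> S \<Longrightarrow> w \<in> words_over S \<Longrightarrow>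
    gen i \<otimes>\<^bsub>G\<^esub> cl w \<otimes>\<^bsub>G\<^esub> gen i = cl ((i, True) # w @ [(i, True)])"
  by (simp add: gen_def mult_cl)

text \<open>Let \<open>j\<close> flip a truth value and all other generators fix it;
  \<open>j\<close> occurs exactly once in the word.\<close>

lemma cl_letters_neq_one:
  assumes "j \<notin> set xs"
  shows "cl (letters (j # xs)) \<noteq> \<one>\<^bsub>G\<^esub>"
proof
  define f where "f a = (if a = j then Not else id)" for a
  assume "cl (letters (j # xs)) = \<one>\<^bsub>G\<^esub>"
  then have "word_act f (letters (j # xs)) True = word_act f [] True"
    by (intro word_act_cong[where X = UNIV]) (auto simp: f_def one_G)
  moreover have "foldr f xs True = True"
    using assms by (induction xs) (auto simp: f_def)
  ultimately show False
    by (simp add: word_act_letters) (simp add: f_def)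
qed

text \<open>
  Two non-adjacent generators map to the reflections \<open>x \<mapsto> 1 - x\<close> and \<open>x \<mapsto> - x\<close> of the
  infinite dihedral group.
\<close>

definition dihedral_act :: "'a \<Rightarrow> 'a \<Rightarrow> 'a \<Rightarrow> int \<Rightarrow> int" where
  "dihedral_act i j a = (if a = i then (\<lambda>x. 1 - x) else if a = j then uminus else id)"

lemma dihedral_act_cong:
  assumes "\<not> E i j" "\<not> E j i" "cl u = cl w"
  shows "word_act (dihedral_act i j) u x = word_act (dihedral_act i j) w x"
  by (rule word_act_cong[where X = UNIV, OF _ _ _ assms(3)])
    (use assms(1,2) in \<open>auto simp: dihedral_act_def\<close>)

lemma dihedral_act_letters:
  assumes "distinct xs" "j \<notin> set xs" "i \<noteq> j"
  shows "word_act (dihedral_act i j) (letters (j # xs)) x = (if i \<in> set xs then x - 1 else - x)"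
proof -
  have "foldr (dihedral_act i j) xs x = (if i \<in> set xs then dihedral_act i j i x else x)"
    by (rule foldr_one_active) (use assms in \<open>auto simp: dihedral_act_def\<close>)
  with assms(3) show ?thesis
    by (auto simp: word_act_letters dihedral_act_def)
qed

text \<open>The reflections of \<open>i\<close> and \<open>j\<close> compose to the translation
  \<open>x - 1\<close>, whose \<open>k\<close>-th power sends 0 to \<open>- k\<close>.\<close>

lemma non_adjacent_infinite_order:
  assumes "i \<noteq> j" "\<not> E i j" "\<not> E j i" "set (j # xs) \<subseteq> S"
    and "distinct xs" "j \<notin> set xs" "i \<in> set xs" "0 < (k :: nat)"
  shows "cl (letters (j # xs)) [^]\<^bsub>G\<^esub> k \<noteq> \<one>\<^bsub>G\<^esub>"
proof
  assume "cl (letters (j # xs)) [^]\<^bsub>G\<^esub> k = \<one>\<^bsub>G\<^esub>"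
  then have "cl (concat (replicate k (letters (j # xs)))) = cl []"
    using cl_power(1)[of "letters (j # xs)" k] assms(4) by (simp add: one_G)
  from dihedral_act_cong[OF assms(2,3) this, of 0]
  have "(word_act (dihedral_act i j) (letters (j # xs)) ^^ k) 0 = 0"
    by (simp only: word_act_concat_replicate word_act_Nil)
  moreover have "(word_act (dihedral_act i j) (letters (j # xs)) ^^ m) 0 = - int m" for m
    by (induction m) (use assms in \<open>simp_all add: dihedral_act_letters del: letters_Cons\<close>)
  ultimately show False using \<open>0 < k\<close> by simp
qed

text \<open>Without the letter \<open>i\<close>, \<open>s\<close> would act as \<open>- x\<close>
  and its conjugate as \<open>2 - x\<close>. These reflections do not commute: the two products send
  0 to -2 and to 2.\<close>

lemma commuting_conjugate_imp_mem:
  assumes "i \<in> S" "i \<noteq> j" "\<not> E i j" "\<not> E j i" "set (j # xs) \<subseteq> S" "distinct xs" "j \<notin> set xs"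
    and s: "s = cl (letters (j # xs))"
    and comm: "s \<otimes>\<^bsub>G\<^esub> (gen i \<otimes>\<^bsub>G\<^esub> s \<otimes>\<^bsub>G\<^esub> gen i) = (gen i \<otimes>\<^bsub>G\<^esub> s \<otimes>\<^bsub>G\<^esub> gen i) \<otimes>\<^bsub>G\<^esub> s"
  shows "i \<in> set xs"
proof (rule ccontr)
  assume "i \<notin> set xs"
  define w where "w = letters (j # xs)"
  have w: "w \<in> words_over S" using assms(5) by (simp add: w_def del: letters_Cons)
  have "cl (w @ (i, True) # w @ [(i, True)]) = cl (((i, True) # w @ [(i, True)]) @ w)"
    using comm w assms(1) by (simp add: s cl_conj_gen mult_cl flip: w_def del: letters_Cons)
  from dihedral_act_cong[OF assms(3,4) this, of 0]
  have "word_act (dihedral_act i j) (w @ (i, True) # w @ [(i, True)]) 0 =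
      word_act (dihedral_act i j) (((i, True) # w @ [(i, True)]) @ w) 0" .
  moreover have "word_act (dihedral_act i j) w x = - x" for x
    using dihedral_act_letters[OF assms(6,7,2), of x] \<open>i \<notin> set xs\<close> by (simp only: w_def) simp
  ultimately show False by (simp add: dihedral_act_def)
qed

text \<open>
  For a generator \<open>j\<close> adjacent to neither \<open>i\<close> nor \<open>i'\<close>, the transpositions \<open>(1 3)\<close>, \<open>(1 2)\<close> and
  \<open>(3 4)\<close> as images of \<open>j\<close>, \<open>i\<close> and \<open>i'\<close> separate the two products.
\<close>

lemma commuting_conjugate_imp_unique:
  assumes "i \<in> S" "i \<noteq> i'" "\<not> E i j" "\<not> E j i" "\<not> E i' j" "\<not> E j i'"
    and "set (j # xs) \<subseteq> S" "distinct xs" "j \<notin> set xs" "i \<in> set xs" "i' \<in> set xs"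
    and s: "s = cl (letters (j # xs))"
    and comm: "s \<otimes>\<^bsub>G\<^esub> (gen i \<otimes>\<^bsub>G\<^esub> s \<otimes>\<^bsub>G\<^esub> gen i) = (gen i \<otimes>\<^bsub>G\<^esub> s \<otimes>\<^bsub>G\<^esub> gen i) \<otimes>\<^bsub>G\<^esub> s"
  shows False
proof -
  define f :: "'a \<Rightarrow> nat \<Rightarrow> nat" where "f a = (if a = j then Transposition.transpose 1 3 else
    if a = i then Transposition.transpose 1 2 else if a = i' then Transposition.transpose 3 4 else id)" for a
  have ij: "i \<noteq> j" "i' \<noteq> j" using assms by auto
  define w where "w = letters (j # xs)"
  have w: "w \<in> words_over S" using assms(7) by (simp add: w_def del: letters_Cons)
  have "f i (f i' x) = f i' (f i x)" for x
    using ij assms(2) by (simp add: f_def Transposition.transpose_def)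
  moreover have "f a = id" if "a \<in> set xs" "a \<noteq> i" "a \<noteq> i'" for a
    using that assms(9) by (auto simp: f_def)
  ultimately have "foldr f xs x = f i (f i' x)" for x
    using foldr_two_active[of xs i i' f x] assms by simp
  then have act: "word_act f w x =
      Transposition.transpose 1 3 (Transposition.transpose 1 2 (Transposition.transpose 3 4 x))" for x
    using ij assms(2) by (simp add: w_def word_act_letters f_def)
  have "cl (w @ (i, True) # w @ [(i, True)]) = cl (((i, True) # w @ [(i, True)]) @ w)"
    using comm w assms(1) by (simp add: s cl_conj_gen mult_cl flip: w_def del: letters_Cons)
  then have "word_act f (w @ (i, True) # w @ [(i, True)]) 1 =
      word_act f (((i, True) # w @ [(i, True)]) @ w) 1"
    by (intro word_act_cong[where X = UNIV])
      (use assms in \<open>auto simp: f_def Transposition.transpose_def\<close>)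
  \<comment> \<open>\<open>w\<close> acts as the cycle 1, 2, 3, 4 and its conjugate as the cycle 1,
    3, 4, 2, so the two products send 1 to 4 and to 1.\<close>
  then show False
    using ij by (simp add: act) (simp add: f_def Transposition.transpose_def)
qed

end


section \<open>The homomorphism to an elementary abelian 2-group\<close>

lemma bit_vec_add_self [simp]: "x + x = (0 :: bit ^ 'n)"
  by (simp add: vec_eq_iff)

lemma N2_group_simps [simp]:
  "carrier N2_group = UNIV" "x \<otimes>\<^bsub>N2_group\<^esub> y = x + y" "\<one>\<^bsub>N2_group\<^esub> = 0"
  by (simp_all add: N2_group_def)

lemma group_N2: "group N2_group"
proof (rule groupI)
  show "\<exists>y\<in>carrier N2_group. y \<otimes>\<^bsub>N2_group\<^esub> x = \<one>\<^bsub>N2_group\<^esub>" for x :: "bit ^ 'n"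
    by (intro bexI[of _ x]) simp_all
qed (simp_all add: add.assoc)

lemma inv_N2 [simp]: "inv\<^bsub>N2_group\<^esub> x = x"
  by (rule group.inv_equality[OF group_N2]) simp_all

lemma word_eval_N2: "word_eval N2_group h w = word_act (\<lambda>a. (+) (h a)) w 0"
proof (induction w)
  case (Cons p w)
  then show ?case by (cases p) (simp add: word_eval_def)
qed (simp add: word_eval_def)

lemma word_act_plus: "word_act (\<lambda>a. (+) (h a)) w x = word_act (\<lambda>a. (+) (h a)) w 0 + (x :: bit ^ 'n)"
  by (induction w) (auto simp: add.assoc)

context racg
begin

text \<open>Translations of a \<open>bit\<close> vector space are commuting involutions, so
  evaluation is constant on a class and \<open>the_elem\<close> is applied to a singleton.\<close>

lemma pres_lift_N2_cl: "pres_lift N2_group h (cl w) = word_act (\<lambda>a. (+) (h a)) w 0"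
proof -
  have "word_eval N2_group h w' = word_act (\<lambda>a. (+) (h a)) w 0" if "w' \<in> cl w" for w'
  proof -
    have "cl w = cl w'"
      unfolding cl_eq_iff using that by (simp add: pres_class_def)
    moreover have "h a + (h a + x) = x" for a x
      by (simp flip: add.assoc)
    ultimately have "word_act (\<lambda>a. (+) (h a)) w 0 = word_act (\<lambda>a. (+) (h a)) w' 0"
      by (intro word_act_cong[where X = UNIV]) (simp_all add: add.left_commute)
    then show ?thesis by (simp add: word_eval_N2)
  qed
  moreover have "w \<in> cl w" by (simp add: pres_class_def)
  ultimately have "word_eval N2_group h ` cl w = {word_act (\<lambda>a. (+) (h a)) w 0}"
    by (intro equalityI subsetI) (simp_all add: image_iff, force+)
  then show ?thesis by (simp add: pres_lift_def)
qed

lemma pres_lift_N2_hom: "group_hom G N2_group (pres_lift N2_group h)"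
proof (intro group_hom.intro group_hom_axioms.intro homI)
  fix x y assume "x \<in> carrier G" "y \<in> carrier G"
  then obtain u w where "u \<in> words_over S" "w \<in> words_over S" "x = cl u" "y = cl w"
    by (auto simp: carrier_G)
  then show "pres_lift N2_group h (x \<otimes>\<^bsub>G\<^esub> y) =
      pres_lift N2_group h x \<otimes>\<^bsub>N2_group\<^esub> pres_lift N2_group h y"
    using word_act_plus[of h u "word_act (\<lambda>a. (+) (h a)) w 0"]
    by (simp add: mult_cl pres_lift_N2_cl)
qed (simp_all add: group_N2)

end

lemma pairing2_sum: "pairing2 u (\<Sum>k\<in>K. c k *s h k) = (\<Sum>k\<in>K. c k * pairing2 u (h k))"
proof -
  have "pairing2 u (\<Sum>k\<in>K. c k *s h k) = (\<Sum>i\<in>UNIV. \<Sum>k\<in>K. c k * (u $ i * h k $ i))"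
    by (simp only: pairing2_def sum_component vector_smult_component sum_distrib_left
      mult.left_commute)
  also have "\<dots> = (\<Sum>k\<in>K. c k * pairing2 u (h k))"
    by (subst sum.swap) (simp only: pairing2_def sum_distrib_left)
  finally show ?thesis .
qed

text \<open>Coefficients modulo 2 are 0 or 1, so a vector is the sum of the basis vectors that its
  dual coordinates select. This will put \<open>S_j\<close> into the kernel.\<close>

lemma dual_basis_expansion:
  fixes h u :: "'i \<Rightarrow> bit ^ 'n"
  assumes "finite I" "family_basis I h"
    and dual: "\<forall>i\<in>I. \<forall>k\<in>I. pairing2 (u i) (h k) = (if i = k then 1 else 0)"
  shows "(\<Sum>i\<in>{i \<in> I. pairing2 (u i) x = 1}. h i) = x"
proof -
  have "x \<in> vec.span (h ` I)" "inj_on h I"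
    using assms(2) by (auto simp: family_basis_def)
  then obtain r where "x = (\<Sum>y\<in>h ` I. r y *s y)"
    using vec.span_finite[of "h ` I"] assms(1) by auto
  then have x: "x = (\<Sum>k\<in>I. r (h k) *s h k)"
    by (simp add: sum.reindex[OF \<open>inj_on h I\<close>])
  have coeff: "pairing2 (u i) x = r (h i)" if "i \<in> I" for i
  proof -
    have "pairing2 (u i) x = (\<Sum>k\<in>I. r (h k) * pairing2 (u i) (h k))"
      by (subst x) (rule pairing2_sum)
    also have "\<dots> = (\<Sum>k\<in>I. if k = i then r (h k) else 0)"
      using dual that by (intro sum.cong refl) auto
    also have "\<dots> = r (h i)"
      using that assms(1) by (subst sum.delta) auto
    finally show ?thesis .
  qed
  have "r y *s z = (if r y = 1 then z else 0)" for y and z :: "bit ^ 'n"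
    by (cases "r y") simp_all
  then have "x = (\<Sum>k\<in>I. if r (h k) = 1 then h k else 0)"
    by (subst x) simp
  also have "\<dots> = (\<Sum>i\<in>{i \<in> I. pairing2 (u i) x = 1}. h i)"
    using assms(1) coeff by (simp add: sum.If_cases Int_def cong: conj_cong)
  finally show ?thesis by simp
qed


section \<open>Transport along an isomorphism of the fundamental group\<close>

text \<open>
  An isomorphism from a group carries its structure over to the set of loop classes, so the only
  property of loops that is needed is that the constant class is idempotent.
\<close>

lemma loop_class_const_mem:
  assumes "x0 \<in> topspace X"
  shows "loop_class X x0 (\<lambda>_. x0) \<in> carrier (fundamental_group X x0)"
  using assms by (auto simp: fundamental_group_def loops_at_def pathin_def)

lemma loop_homotopic_join_const:
  assumes "loop_homotopic X x0 p (\<lambda>_. x0)" "loop_homotopic X x0 q (\<lambda>_. x0)"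
  shows "loop_homotopic X x0 (loop_join p q) (\<lambda>_. x0)"
proof -
  let ?I = "top_of_set {0..1::real}"
  have prod: "prod_topology ?I ?I = top_of_set ({0..1} \<times> {0..1})"
    by (simp flip: euclidean_product_topology subtopology_Times)
  obtain h where h: "continuous_map (prod_topology ?I ?I) X h" "\<And>x. h (0, x) = p x"
    "\<And>x. h (1, x) = x0" "\<And>t. t \<in> {0..1} \<Longrightarrow> h (t, 0) = x0 \<and> h (t, 1) = x0"
    using assms(1) by (auto simp: loop_homotopic_def homotopic_with_def)
  obtain k where k: "continuous_map (prod_topology ?I ?I) X k" "\<And>x. k (0, x) = q x"
    "\<And>x. k (1, x) = x0" "\<And>t. t \<in> {0..1} \<Longrightarrow> k (t, 0) = x0 \<and> k (t, 1) = x0"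
    using assms(2) by (auto simp: loop_homotopic_def homotopic_with_def)
  define H where "H z = (if snd z \<le> 1/2 then h (fst z, 2 * snd z) else k (fst z, 2 * snd z - 1))"
    for z :: "real \<times> real"
  have "continuous_map (prod_topology ?I ?I) X H"
    unfolding H_def
  proof (rule continuous_map_cases_le)
    show "continuous_map (prod_topology ?I ?I) euclideanreal snd"
      unfolding prod by (simp add: continuous_on_snd)
    show "continuous_map (prod_topology ?I ?I) euclideanreal (\<lambda>_. 1/2)" by simp
    have "continuous_map (subtopology (prod_topology ?I ?I)
          {z \<in> topspace (prod_topology ?I ?I). snd z \<le> 1/2})
        (prod_topology ?I ?I) (\<lambda>z. (fst z, 2 * snd z))"
      unfolding prod by (auto simp: subtopology_subtopology intro!: continuous_intros)
    from continuous_map_compose[OF this h(1)]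
    show "continuous_map (subtopology (prod_topology ?I ?I)
        {z \<in> topspace (prod_topology ?I ?I). snd z \<le> 1/2}) X (\<lambda>z. h (fst z, 2 * snd z))"
      by (simp add: o_def)
    have "continuous_map (subtopology (prod_topology ?I ?I)
          {z \<in> topspace (prod_topology ?I ?I). 1/2 \<le> snd z})
        (prod_topology ?I ?I) (\<lambda>z. (fst z, 2 * snd z - 1))"
      unfolding prod by (auto simp: subtopology_subtopology intro!: continuous_intros)
    from continuous_map_compose[OF this k(1)]
    show "continuous_map (subtopology (prod_topology ?I ?I)
        {z \<in> topspace (prod_topology ?I ?I). 1/2 \<le> snd z}) X (\<lambda>z. k (fst z, 2 * snd z - 1))"
      by (simp add: o_def)
    \<comment> \<open>On the seam \<open>h\<close> is at the end of its loop and \<open>k\<close> at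
      the start; both homotopies keep the endpoints at \<open>x0\<close>.\<close>
    show "h (fst z, 2 * snd z) = k (fst z, 2 * snd z - 1)"
      if "z \<in> topspace (prod_topology ?I ?I)" "snd z = 1/2" for z
    proof -
      have "fst z \<in> {0..1}" using that(1) by auto
      then show ?thesis
        unfolding that(2) using h(4)[of "fst z"] k(4)[of "fst z"] by simp
    qed
  qed
  then show ?thesis
    unfolding loop_homotopic_def homotopic_with_def
    using h k by (intro exI[of _ H]) (auto simp: H_def loop_join_def)
qed

lemma fundamental_group_one_idem:
  assumes "x0 \<in> topspace X"
  shows "\<one>\<^bsub>fundamental_group X x0\<^esub> \<otimes>\<^bsub>fundamental_group X x0\<^esub> \<one>\<^bsub>fundamental_group X x0\<^esub> =
    \<one>\<^bsub>fundamental_group X x0\<^esub>"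
proof -
  let ?c = "\<lambda>_. x0"
  have const: "?c \<in> loop_class X x0 ?c"
    using assms
    by (auto simp: loop_class_def loops_at_def pathin_def loop_homotopic_def)
  have "loop_class X x0 (loop_join p q) = loop_class X x0 ?c"
    if "p \<in> loop_class X x0 ?c" "q \<in> loop_class X x0 ?c" for p q
  proof -
    have "loop_homotopic X x0 p ?c" "loop_homotopic X x0 q ?c"
      using that by (auto simp: loop_class_def loop_homotopic_def intro: homotopic_with_symD)
    then have pq: "loop_homotopic X x0 (loop_join p q) ?c"
      by (rule loop_homotopic_join_const)
    then have "loop_homotopic X x0 (loop_join p q) r \<longleftrightarrow> loop_homotopic X x0 ?c r" for r
      unfolding loop_homotopic_def
      by (blast intro: homotopic_with_trans homotopic_with_symD)
    then show ?thesis by (simp add: loop_class_def)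
  qed
  with const have "(\<Union>p\<in>loop_class X x0 ?c. \<Union>q\<in>loop_class X x0 ?c.
      loop_class X x0 (loop_join p q)) = loop_class X x0 ?c"
    by blast
  then show ?thesis by (simp add: fundamental_group_def)
qed

text \<open>\<open>Q\<close> is not assumed to be a group. The preimage of its unit is idempotent,
  hence the identity of \<open>P\<close>, and the group laws then carry over through the
  bijection.\<close>

lemma iso_group_hom:
  assumes "group P" "h \<in> iso P Q"
    and one: "\<one>\<^bsub>Q\<^esub> \<in> carrier Q" "\<one>\<^bsub>Q\<^esub> \<otimes>\<^bsub>Q\<^esub> \<one>\<^bsub>Q\<^esub> = \<one>\<^bsub>Q\<^esub>"
  shows "group_hom P Q h"
proof -
  interpret P: group P by fact
  have bij: "bij_betw h (carrier P) (carrier Q)"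
    and mult: "\<And>x y. x \<in> carrier P \<Longrightarrow> y \<in> carrier P \<Longrightarrow> h (x \<otimes>\<^bsub>P\<^esub> y) = h x \<otimes>\<^bsub>Q\<^esub> h y"
    and hom: "h \<in> hom P Q"
    using assms(2) by (auto simp: iso_def hom_def)
  have carrier: "carrier Q = h ` carrier P" using bij by (simp add: bij_betw_def)
  obtain e where e: "e \<in> carrier P" "\<one>\<^bsub>Q\<^esub> = h e" using one(1) carrier by auto
  then have "h (e \<otimes>\<^bsub>P\<^esub> e) = h e" using one(2) mult by simp
  then have "e \<otimes>\<^bsub>P\<^esub> e = e"
    using bij e(1) by (meson P.m_closed bij_betw_def inj_onD)
  then have "\<one>\<^bsub>Q\<^esub> = h \<one>\<^bsub>P\<^esub>" using e P.r_cancel_one by blast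
  have "group Q"
  proof (rule groupI)
    fix x assume "x \<in> carrier Q"
    then obtain y where "y \<in> carrier P" "x = h y" using carrier by auto
    then show "\<exists>z\<in>carrier Q. z \<otimes>\<^bsub>Q\<^esub> x = \<one>\<^bsub>Q\<^esub>"
      using mult[of "inv\<^bsub>P\<^esub> y" y] \<open>\<one>\<^bsub>Q\<^esub> = h \<one>\<^bsub>P\<^esub>\<close>
      by (intro bexI[of _ "h (inv\<^bsub>P\<^esub> y)"]) (simp_all add: carrier)
  qed (use one(1) \<open>\<one>\<^bsub>Q\<^esub> = h \<one>\<^bsub>P\<^esub>\<close> in \<open>auto simp: carrier P.m_assoc simp flip: mult\<close>)
  then show ?thesis
    using hom by (intro group_hom.intro group_hom_axioms.intro) (simp_all add: assms(1))
qed

lemma iso_ord: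
  assumes "group_hom P Q h" "h \<in> iso P Q" "x \<in> carrier P"
  shows "group.ord Q (h x) = group.ord P x"
proof -
  interpret group_hom P Q h by fact
  have "inj_on h (carrier P)" using assms(2) by (simp add: iso_def bij_betw_def)
  then have "h x [^]\<^bsub>Q\<^esub> n = \<one>\<^bsub>Q\<^esub> \<longleftrightarrow> x [^]\<^bsub>P\<^esub> n = \<one>\<^bsub>P\<^esub>" for n :: nat
    using assms(3) by (metis G.nat_pow_closed G.one_closed hom_nat_pow hom_one inj_onD)
  then show ?thesis
    using assms(3) by (subst H.ord_unique) (simp_all add: G.pow_eq_id)
qed

section \<open>The elements \<open>S_j\<close> and their orders in the kernel\<close>

lemma (in group) ord_eq_2: "x \<in> carrier G \<Longrightarrow> ord x = 2 \<longleftrightarrow> x \<noteq> \<one> \<and> x \<otimes> x = \<one>"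
  using pow_eq_id[of x 2] ord_eq_1[of x] two_is_prime_nat
  by (auto simp: numeral_2_eq_2 prime_nat_iff)

text \<open>Exponents 0 and 1 drop or keep a factor, so filtering the indices gives one positive
  word for \<open>S_j\<close>.\<close>

lemma S_elem_eq_cl:
  fixes \<Delta> :: "(real ^ 'n) set set"
  assumes "CARD('n) \<le> d" "j \<in> {1..d}"
  shows "S_elem \<Delta> d v u j = pres_class {1..d} (racg_relators {1..d} (\<lambda>i k. cone2 (v i) (v k) \<in> \<Delta>))
    (letters (j # filter (\<lambda>i. pairing2 (u i) (mod2 (v j)) = 1) [1..<Suc CARD('n)]))"
proof -
  define S where "S = {1..d}"
  define E where "E i k \<longleftrightarrow> cone2 (v i) (v k) \<in> \<Delta>" for i k
  interpret racg S E .
  define Q where "Q i \<longleftrightarrow> pairing2 (u i) (mod2 (v j)) = 1" for i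
  have relators: "W_relators \<Delta> d v = racg_relators S E"
    by (simp add: W_relators_def racg_relators_def S_def E_def)
  have W: "W_group \<Delta> d v = G" "W_gen \<Delta> d v = gen"
    by (simp_all only: W_group_def W_gen_def gen_def relators fun_eq_iff flip: S_def) simp
  have "foldr (\<lambda>i g. gen i [^]\<^bsub>G\<^esub> (of_bool (Q i) :: nat) \<otimes>\<^bsub>G\<^esub> g) xs \<one>\<^bsub>G\<^esub> =
      cl (letters (filter Q xs))" if "set xs \<subseteq> S" for xs
    using that
  proof (induction xs)
    case (Cons a xs)
    then have "set (filter Q xs) \<subseteq> S" by auto
    with Cons show ?case by (simp add: cl_Cons)
  qed (simp add: one_G)
  moreover have "set [1..<Suc CARD('n)] \<subseteq> S" "j \<in> S"
    using assms by (auto simp: S_def)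
  moreover from this have "set (filter Q [1..<Suc CARD('n)]) \<subseteq> S" by auto
  ultimately have "S_elem \<Delta> d v u j = cl (letters (j # filter Q [1..<Suc CARD('n)]))"
    unfolding S_elem_def W Q_def[symmetric] by (simp only: cl_letters_Cons)
  then show ?thesis
    by (simp only: S_def E_def[abs_def] Q_def[abs_def])
qed

definition torsion_order_2 :: "('a, 'm) monoid_scheme \<Rightarrow> bool" where
  "torsion_order_2 P \<longleftrightarrow> (\<forall>g\<in>carrier P.
     g \<noteq> \<one>\<^bsub>P\<^esub> \<and> (\<exists>k::nat. 0 < k \<and> g [^]\<^bsub>P\<^esub> k = \<one>\<^bsub>P\<^esub>) \<longrightarrow> group.ord P g = 2)"

lemma kernel_structure:
  fixes \<Delta> :: "(real ^ 'n) set set"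
    and d :: nat
    and v :: "nat \<Rightarrow> int ^ 'n"
    and u :: "nat \<Rightarrow> bit ^ 'n"
  defines "P \<equiv> W_kernel \<Delta> d v" and "s \<equiv> S_elem \<Delta> d v u"
  assumes n_le_d: "CARD('n) \<le> d"
    and basis: "family_basis {1..CARD('n)} (\<lambda>i. mod2 (v i))"
    and dual_basis: "\<forall>i\<in>{1..CARD('n)}. \<forall>k\<in>{1..CARD('n)}.
           pairing2 (u i) (mod2 (v k)) = (if i = k then 1 else 0)"
    and cones: "\<forall>p\<in>{1..CARD('n)}. \<forall>q\<in>{1..CARD('n)}. cone2 (v p) (v q) \<in> \<Delta>"
  shows "group P"
    and "torsion_order_2 P"
    and "\<forall>j\<in>{CARD('n) + 1..d}. s j \<in> carrier P"
    and "comm_group P \<Longrightarrow> \<forall>j\<in>{CARD('n) + 1..d}.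
          (group.ord P (s j) = 2 \<longleftrightarrow> (\<forall>i\<in>{1..CARD('n)}. cone2 (v j) (v i) \<in> \<Delta>)) \<and>
          (group.ord P (s j) = 0 \<longleftrightarrow> (\<exists>!i. i \<in> {1..CARD('n)} \<and> cone2 (v j) (v i) \<notin> \<Delta>))"
proof -
  define E where "E i k \<longleftrightarrow> cone2 (v i) (v k) \<in> \<Delta>" for i k
  have E_sym: "E i k \<longleftrightarrow> E k i" for i k
    by (simp add: E_def cone2_def insert_commute)
  define S where "S = {1..d}"
  interpret racg S E .
  define h where "h i = mod2 (v i)" for i
  define \<phi> where "\<phi> = pres_lift N2_group h"
  define K where "K = kernel G N2_group \<phi>"
  interpret \<phi>: group_hom G N2_group \<phi>
    unfolding \<phi>_def by (rule pres_lift_N2_hom)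
  have "W_group \<Delta> d v = G"
    by (simp add: W_group_def W_relators_def racg_relators_def E_def S_def)
  then have P: "P = G\<lparr>carrier := K\<rparr>"
    by (simp add: P_def W_kernel_def K_def \<phi>_def phi_hat_def h_def[abs_def])
  have K_iff: "cl w \<in> K \<longleftrightarrow> word_act (\<lambda>a. (+) (h a)) w 0 = 0" if "w \<in> words_over S" for w
    using that by (simp add: K_def kernel_def \<phi>_def pres_lift_N2_cl)
  have sub: "subgroup K G"
    unfolding K_def by (rule \<phi>.subgroup_kernel)
  then have K_carrier: "K \<subseteq> carrier G" by (rule subgroup.subset)
  show groupP: "group P"
    unfolding P using sub group_G by (rule subgroup.subgroup_is_group)
  interpret P: group P by (rule groupP)
  have carrier_P: "carrier P = K" and one_P: "\<one>\<^bsub>P\<^esub> = \<one>\<^bsub>G\<^esub>"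
    and mult_P: "x \<otimes>\<^bsub>P\<^esub> y = x \<otimes>\<^bsub>G\<^esub> y" and pow_P: "x [^]\<^bsub>P\<^esub> k = x [^]\<^bsub>G\<^esub> k"
    for x y and k :: nat
    by (simp_all add: P nat_pow_def)
  have ord_2: "group.ord P g = 2 \<longleftrightarrow> g \<noteq> \<one>\<^bsub>G\<^esub> \<and> g \<otimes>\<^bsub>G\<^esub> g = \<one>\<^bsub>G\<^esub>" if "g \<in> K" for g
    using P.ord_eq_2[of g] that by (simp only: carrier_P one_P mult_P)
  \<comment> \<open>The value 0 of \<open>ord\<close> encodes infinite order.\<close>
  have ord_0: "group.ord P g = 0 \<longleftrightarrow> (\<forall>k::nat. k \<noteq> 0 \<longrightarrow> g [^]\<^bsub>G\<^esub> k \<noteq> \<one>\<^bsub>G\<^esub>)" if "g \<in> K" for g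
    using P.ord_eq_0[of g] that by (simp only: carrier_P one_P pow_P)
  show "torsion_order_2 P"
    unfolding torsion_order_2_def
  proof (intro ballI impI)
    fix g
    assume g: "g \<in> carrier P" "g \<noteq> \<one>\<^bsub>P\<^esub> \<and> (\<exists>k::nat. 0 < k \<and> g [^]\<^bsub>P\<^esub> k = \<one>\<^bsub>P\<^esub>)"
    then obtain k :: nat where "0 < k" "g [^]\<^bsub>G\<^esub> k = \<one>\<^bsub>G\<^esub>"
      by (auto simp only: one_P pow_P)
    moreover have "g \<in> carrier G" using g(1) K_carrier carrier_P by blast
    ultimately have "g \<otimes>\<^bsub>G\<^esub> g = \<one>\<^bsub>G\<^esub>" by (intro torsion_square) (auto simp: S_def)
    with g show "group.ord P g = 2" by (simp add: ord_2 carrier_P one_P)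
  qed
  define xs where "xs j = filter (\<lambda>i. pairing2 (u i) (h j) = 1) [1..<Suc CARD('n)]" for j
  have set_xs: "set (xs j) = {i \<in> {1..CARD('n)}. pairing2 (u i) (h j) = 1}" for j
    by (simp only: xs_def set_filter set_upt atLeastLessThanSuc_atLeastAtMost)
  have xs_dist: "distinct (xs j)" for j by (simp add: xs_def)
  have s_cl: "s j = cl (letters (j # xs j))" if "j \<in> S" for j
    using S_elem_eq_cl[OF n_le_d that[unfolded S_def], of \<Delta> v u]
    by (simp only: s_def xs_def h_def E_def[abs_def] S_def)
  have sub_xs: "set (j # xs j) \<subseteq> S" if "j \<in> {CARD('n) + 1..d}" for j
    using that n_le_d by (auto simp: set_xs S_def)
  have s_K: "s j \<in> K" if j: "j \<in> {CARD('n) + 1..d}" for j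
  proof -
    have "foldr (\<lambda>a. (+) (h a)) zs 0 = sum_list (map h zs)" for zs
      by (induction zs) auto
    then have "foldr (\<lambda>a. (+) (h a)) (xs j) 0 = (\<Sum>i\<in>set (xs j). h i)"
      by (simp add: sum_list_distinct_conv_sum_set xs_dist)
    \<comment> \<open>The selected basis vectors add up to \<open>h j\<close>; the leading letter
      contributes \<open>h j\<close> once more, and the total vanishes modulo 2.\<close>
    also have "\<dots> = h j"
      unfolding set_xs using basis dual_basis
      by (intro dual_basis_expansion) (simp_all add: h_def[abs_def])
    finally have "word_act (\<lambda>a. (+) (h a)) (letters (j # xs j)) 0 = 0"
      by (simp add: word_act_letters)
    moreover have "s j = cl (letters (j # xs j))"
      using j by (intro s_cl) (simp add: S_def)
    ultimately show ?thesis
      using K_iff[of "letters (j # xs j)"] sub_xs[OF j] by (simp only: letters_words)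
  qed
  then show "\<forall>j\<in>{CARD('n) + 1..d}. s j \<in> carrier P" by (simp add: carrier_P)
  assume comm: "comm_group P"
  show "\<forall>j\<in>{CARD('n) + 1..d}.
          (group.ord P (s j) = 2 \<longleftrightarrow> (\<forall>i\<in>{1..CARD('n)}. cone2 (v j) (v i) \<in> \<Delta>)) \<and>
          (group.ord P (s j) = 0 \<longleftrightarrow> (\<exists>!i. i \<in> {1..CARD('n)} \<and> cone2 (v j) (v i) \<notin> \<Delta>))"
  proof
    fix j
    assume j: "j \<in> {CARD('n) + 1..d}"
    have j_xs: "j \<notin> set (xs j)" and j_d: "j \<in> S"
      using j by (auto simp: set_xs S_def)
    note sj = s_cl[OF j_d]
    have conj_commute: "s j \<otimes>\<^bsub>G\<^esub> (gen i \<otimes>\<^bsub>G\<^esub> s j \<otimes>\<^bsub>G\<^esub> gen i) =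
        (gen i \<otimes>\<^bsub>G\<^esub> s j \<otimes>\<^bsub>G\<^esub> gen i) \<otimes>\<^bsub>G\<^esub> s j" if i: "i \<in> S" for i
    proof -
      have words: "letters (j # xs j) \<in> words_over S"
        using sub_xs[OF j] by (simp only: letters_words)
      have "word_act (\<lambda>a. (+) (h a)) (letters (j # xs j)) 0 = 0"
        using s_K[OF j] K_iff[OF words] sj by simp
      \<comment> \<open>Conjugation by \<open>gen i\<close> adds \<open>h i\<close> twice, so the
        conjugate stays in the kernel, where commutativity applies.\<close>
      then have "word_act (\<lambda>a. (+) (h a)) ((i, True) # letters (j # xs j) @ [(i, True)]) 0 = 0"
        using word_act_plus[of h "letters (j # xs j)" "h i"] by simp
      then have "gen i \<otimes>\<^bsub>G\<^esub> s j \<otimes>\<^bsub>G\<^esub> gen i \<in> K"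
        using K_iff[of "(i, True) # letters (j # xs j) @ [(i, True)]"] words i
        by (simp add: sj cl_conj_gen del: letters_Cons)
      then show ?thesis
        using comm_groupE(4)[OF comm, of "s j" "gen i \<otimes>\<^bsub>G\<^esub> s j \<otimes>\<^bsub>G\<^esub> gen i"] s_K[OF j]
        by (simp only: carrier_P mult_P)
    qed
    have E_xs: "E a b" if "a \<in> set (xs j)" "b \<in> set (xs j)" for a b
      using that cones by (auto simp: set_xs E_def)
    have adjacent: "group.ord P (s j) = 2" if all: "\<forall>i\<in>{1..CARD('n)}. E j i"
    proof -
      have "s j \<otimes>\<^bsub>G\<^esub> s j = \<one>\<^bsub>G\<^esub>"
        unfolding sj using all j_xs xs_dist E_xs E_sym sub_xs[OF j] j_d
        by (intro letters_square) (auto simp: set_xs)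
      moreover have "s j \<noteq> \<one>\<^bsub>G\<^esub>"
        unfolding sj by (rule cl_letters_neq_one[OF j_xs])
      ultimately show ?thesis using ord_2[OF s_K[OF j]] by simp
    qed
    have mem: "i \<in> set (xs j)" if "i \<in> {1..CARD('n)}" "\<not> E j i" for i
      using that j n_le_d E_sym[of i j]
      by (intro commuting_conjugate_imp_mem[OF _ _ _ _ sub_xs[OF j] xs_dist j_xs sj conj_commute])
        (auto simp: S_def)
    have non_adjacent: "group.ord P (s j) = 0" if i: "i \<in> {1..CARD('n)}" "\<not> E j i" for i
    proof -
      have "s j [^]\<^bsub>G\<^esub> k \<noteq> \<one>\<^bsub>G\<^esub>" if "k \<noteq> 0" for k :: nat
        unfolding sj using that i j E_sym[of i j] mem[OF i]
        by (intro non_adjacent_infinite_order[OF _ _ _ sub_xs[OF j] xs_dist j_xs]) auto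
      then show ?thesis using ord_0[OF s_K[OF j]] by blast
    qed
    have unique: "i = i'"
      if i: "i \<in> {1..CARD('n)}" "\<not> E j i" and i': "i' \<in> {1..CARD('n)}" "\<not> E j i'" for i i'
    proof (rule ccontr)
      assume "i \<noteq> i'"
      moreover have "i \<in> S" using i n_le_d by (auto simp: S_def)
      ultimately show False
        using i i' E_sym[of i j] E_sym[of i' j]
        by (intro commuting_conjugate_imp_unique[OF _ _ _ _ _ _ sub_xs[OF j] xs_dist j_xs
              mem[OF i] mem[OF i'] sj conj_commute]) auto
    qed
    \<comment> \<open>Commutativity leaves two cases: no non-neighbour and order 2, or exactly one
      and order 0. They exclude each other, which turns both implications into equivalences.\<close>
    have "(group.ord P (s j) = 2 \<longleftrightarrow> (\<forall>i\<in>{1..CARD('n)}. E j i)) \<and>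
        (group.ord P (s j) = 0 \<longleftrightarrow> (\<exists>!i. i \<in> {1..CARD('n)} \<and> \<not> E j i))"
    proof (cases "\<forall>i\<in>{1..CARD('n)}. E j i")
      case True
      then have "\<not> (\<exists>!i. i \<in> {1..CARD('n)} \<and> \<not> E j i)" by blast
      with True adjacent show ?thesis by simp
    next
      case False
      then obtain i where i: "i \<in> {1..CARD('n)}" "\<not> E j i" by blast
      then have "\<exists>!i. i \<in> {1..CARD('n)} \<and> \<not> E j i"
        using unique by blast
      with False non_adjacent[OF i] show ?thesis by simp
    qed
    then show "(group.ord P (s j) = 2 \<longleftrightarrow> (\<forall>i\<in>{1..CARD('n)}. cone2 (v j) (v i) \<in> \<Delta>)) \<and>
        (group.ord P (s j) = 0 \<longleftrightarrow> (\<exists>!i. i \<in> {1..CARD('n)} \<and> cone2 (v j) (v i) \<notin> \<Delta>))"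
      by (simp only: E_def)
  qed
qed

section \<open>Transfer of the conclusions to the group of loop classes\<close>

lemma torsion_order_2_iso:
  assumes "group_hom P Q h" "h \<in> iso P Q" "torsion_order_2 P"
  shows "torsion_order_2 Q"
  unfolding torsion_order_2_def
proof (intro ballI impI)
  interpret group_hom P Q h by fact
  fix y
  assume y: "y \<in> carrier Q" "y \<noteq> \<one>\<^bsub>Q\<^esub> \<and> (\<exists>k::nat. 0 < k \<and> y [^]\<^bsub>Q\<^esub> k = \<one>\<^bsub>Q\<^esub>)"
  have bij: "bij_betw h (carrier P) (carrier Q)" using assms(2) by (simp add: iso_def)
  then obtain x where x: "x \<in> carrier P" "y = h x"
    using y(1) by (auto simp: bij_betw_def)
  have "x \<noteq> \<one>\<^bsub>P\<^esub>" using x y(2) by auto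
  moreover have "G.ord x \<noteq> 0"
    using y x by (simp add: iso_ord[OF assms(1,2), symmetric] H.ord_eq_0)
  then have "\<exists>k::nat. 0 < k \<and> x [^]\<^bsub>P\<^esub> k = \<one>\<^bsub>P\<^esub>"
    using x(1) by (auto simp: G.ord_eq_0)
  ultimately have "G.ord x = 2"
    using x(1) assms(3) by (auto simp: torsion_order_2_def)
  with x show "H.ord y = 2" by (simp add: iso_ord[OF assms(1,2)])
qed

lemma comm_group_iso:
  assumes "group_hom P Q h" "h \<in> iso P Q" "comm_group Q"
  shows "comm_group P"
proof -
  interpret group_hom P Q h by fact
  interpret Q: comm_group Q by fact
  have "inj_on h (carrier P)" using assms(2) by (simp add: iso_def bij_betw_def)
  then show ?thesis
    by (intro G.group_comm_groupI) (metis G.m_closed Q.m_comm hom_closed hom_mult inj_onD)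
qed

theorem mainTheorem6:
  fixes \<Delta> :: "(real ^ 'n) set set"
    and d :: nat
    and v :: "nat \<Rightarrow> int ^ 'n"
    and u :: "nat \<Rightarrow> bit ^ 'n"
  assumes fan: "smooth_fan \<Delta>"
    and edges: "bij_betw v {1..d} (primitive_edge_vectors \<Delta>)"
    and connected: "connected_space (real_toric_variety \<Delta>)"
    and n_le_d: "CARD('n) \<le> d"
    and basis: "family_basis {1..CARD('n)} (\<lambda>i. mod2 (v i))"
    and dual_basis: "\<forall>i\<in>{1..CARD('n)}. \<forall>k\<in>{1..CARD('n)}.
           pairing2 (u i) (mod2 (v k)) = (if i = k then 1 else 0)"
    and cones: "\<forall>p\<in>{1..CARD('n)}. \<forall>q\<in>{1..CARD('n)}. cone2 (v p) (v q) \<in> \<Delta>"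
  shows
    (* first conjunct: the fundamental group as the kernel of W(\<Delta>) \<rightarrow> N \<otimes> Z_2;
       second conjunct: the group of homotopy classes of loops, for every base point and
       every identification of it with that kernel *)
    "(let P = W_kernel \<Delta> d v; S = S_elem \<Delta> d v u in
       group P \<and>
       (\<forall>g\<in>carrier P. g \<noteq> \<one>\<^bsub>P\<^esub> \<and> (\<exists>k::nat. 0 < k \<and> g [^]\<^bsub>P\<^esub> k = \<one>\<^bsub>P\<^esub>)
          \<longrightarrow> group.ord P g = 2) \<and>
       (\<forall>j\<in>{CARD('n) + 1..d}. S j \<in> carrier P) \<and>
       (comm_group P \<longrightarrow> (\<forall>j\<in>{CARD('n) + 1..d}.
          (group.ord P (S j) = 2 \<longleftrightarrow> (\<forall>i\<in>{1..CARD('n)}. cone2 (v j) (v i) \<in> \<Delta>)) \<and>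
          (group.ord P (S j) = 0 \<longleftrightarrow> (\<exists>!i. i \<in> {1..CARD('n)} \<and> cone2 (v j) (v i) \<notin> \<Delta>))))) \<and>
     (\<forall>x0 \<in> topspace (real_toric_variety \<Delta>).
      \<forall>\<iota> \<in> iso (W_kernel \<Delta> d v) (fundamental_group (real_toric_variety \<Delta>) x0).
      let P = fundamental_group (real_toric_variety \<Delta>) x0; S = (\<lambda>j. \<iota> (S_elem \<Delta> d v u j)) in
       group P \<and>
       (\<forall>g\<in>carrier P. g \<noteq> \<one>\<^bsub>P\<^esub> \<and> (\<exists>k::nat. 0 < k \<and> g [^]\<^bsub>P\<^esub> k = \<one>\<^bsub>P\<^esub>)
          \<longrightarrow> group.ord P g = 2) \<and>
       (\<forall>j\<in>{CARD('n) + 1..d}. S j \<in> carrier P) \<and>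
       (comm_group P \<longrightarrow> (\<forall>j\<in>{CARD('n) + 1..d}.
          (group.ord P (S j) = 2 \<longleftrightarrow> (\<forall>i\<in>{1..CARD('n)}. cone2 (v j) (v i) \<in> \<Delta>)) \<and>
          (group.ord P (S j) = 0 \<longleftrightarrow> (\<exists>!i. i \<in> {1..CARD('n)} \<and> cone2 (v j) (v i) \<notin> \<Delta>)))))"
proof -
  let ?claim = "\<lambda>P S. group P \<and>
       (\<forall>g\<in>carrier P. g \<noteq> \<one>\<^bsub>P\<^esub> \<and> (\<exists>k::nat. 0 < k \<and> g [^]\<^bsub>P\<^esub> k = \<one>\<^bsub>P\<^esub>)
          \<longrightarrow> group.ord P g = 2) \<and>
       (\<forall>j\<in>{CARD('n) + 1..d}. S j \<in> carrier P) \<and>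
       (comm_group P \<longrightarrow> (\<forall>j\<in>{CARD('n) + 1..d}.
          (group.ord P (S j) = 2 \<longleftrightarrow> (\<forall>i\<in>{1..CARD('n)}. cone2 (v j) (v i) \<in> \<Delta>)) \<and>
          (group.ord P (S j) = 0 \<longleftrightarrow> (\<exists>!i. i \<in> {1..CARD('n)} \<and> cone2 (v j) (v i) \<notin> \<Delta>))))"
  let ?W = "W_kernel \<Delta> d v" and ?S = "S_elem \<Delta> d v u"
  note K = kernel_structure[OF n_le_d basis dual_basis cones]
  have kernel: "?claim ?W ?S"
    by (intro conjI impI K K(2)[unfolded torsion_order_2_def])
  have loops: "?claim (fundamental_group (real_toric_variety \<Delta>) x0) (\<lambda>j. \<iota> (?S j))"
    if x0: "x0 \<in> topspace (real_toric_variety \<Delta>)"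
      and iso: "\<iota> \<in> iso ?W (fundamental_group (real_toric_variety \<Delta>) x0)" for x0 \<iota>
  proof -
    define Q where "Q = fundamental_group (real_toric_variety \<Delta>) x0"
    note iso_Q = iso[folded Q_def]
    have hom: "group_hom ?W Q \<iota>"
      using K(1) iso_Q
    proof (rule iso_group_hom)
      show "\<one>\<^bsub>Q\<^esub> \<in> carrier Q"
        using loop_class_const_mem[OF x0] by (simp add: Q_def) (simp add: fundamental_group_def)
      show "\<one>\<^bsub>Q\<^esub> \<otimes>\<^bsub>Q\<^esub> \<one>\<^bsub>Q\<^esub> = \<one>\<^bsub>Q\<^esub>"
        unfolding Q_def by (rule fundamental_group_one_idem[OF x0])
    qed
    have "group Q" using hom by (simp add: group_hom_def)
    moreover have "\<forall>j\<in>{CARD('n) + 1..d}. \<iota> (?S j) \<in> carrier Q"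
      using K(3) group_hom.hom_closed[OF hom] by blast
    moreover have "group.ord Q (\<iota> (?S j)) = group.ord ?W (?S j)" if "j \<in> {CARD('n) + 1..d}" for j
      using iso_ord[OF hom iso_Q] K(3) that by blast
    ultimately show ?thesis
      using K(4) comm_group_iso[OF hom iso_Q]
        torsion_order_2_iso[OF hom iso_Q K(2), unfolded torsion_order_2_def]
      unfolding Q_def[symmetric] by (intro conjI impI) simp_all
  qed
  show ?thesis
    unfolding Let_def by (intro conjI[OF kernel] ballI loops)
qed

end
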